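(* Let $J\in\mathbb{N}$, let $\mu_1,\dots,\mu_J>0$, $0<\lambda<\infty$, a price set $\mathcal{A}\subset\mathbb{R}_+$ containing at least one positive price, and a reservation-price distribution function $F$ be given with $\lambda\sum_{j=1}^J 1/\mu_j<1$ and $1-F(a-)>0$ for all $a\in\mathcal{A}$. Let $a_*\in\mathcal{A}$ be an optimal solution of $\max_{a\in\mathcal{A}} a\lambda(1-F(a-))$, and let $\pi_{a_*}$ be the static policy quoting $a_*$ in every state. Assume the maxima of the gain over $\Pi$ and over $\Pi_{\mathrm{STATIC}}$ written below are attained. Then there are constants $c>0$ and $0<p<1$, depending only on $\mu_1,\dots,\mu_J$ and $\lambda(1-F(a_*-))$, such that for any $B_2,\dots,B_J\in\mathbb{Z}_+$ and all sufficiently large $B_1$, $$1-c\,p^{B_1-1}\;\le\;\frac{g^{\pi_{a_*}}(B_1,B_2,\dots,B_J)}{\max_{\pi\in\Pi}g^\pi(B_1,B_2,\dots,B_J)}\;\le\;1$$ and $$1-c\,p^{B_1-1}\;\le\;\frac{\max_{\pi\in\Pi_{\mathrm{STATIC}}}g^{\pi}(B_1,B_2,\dots,B_J)}{\max_{\pi\in\Pi}g^\pi(B_1,B_2,\dots,B_J)}\;\le\;1.$$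
   Context: Notation: $\mathbb{Z}_+=\{0,1,2,\dots\}$, $[n]=\{0,1,\dots,n\}$, $f(a-)=\lim_{x\uparrow a}f(x)$, and $\mathbf{e}_j$ is the $j$-th standard unit vector of $\mathbb{R}^J$. Tandem queueing system $(B_1,\dots,B_J)\in\mathbb{Z}_+^J$: $J$ single-server first-come first-served stations in series; station $j$ has a buffer of size $B_j$, so it holds at most $B_j+1$ customers including the one in service; service times at station $j$ are exponential with rate $\mu_j$, all independent. Customers arrive at station 1 as a Poisson process of rate $\lambda$ and have i.i.d. reservation prices with cumulative distribution function $F$. An arriving customer enters if and only if station 1 is not full and the quoted price is at most her reservation price (so if price $a$ is quoted and station 1 is not full she enters with probability $1-F(a-)$); otherwise she is lost. A customer who enters visits stations $1,\dots,J$ in order and then leaves. Communication blocking: the server at station $j$ may not start service while station $j+1$ is full. State space: $\mathcal{S}=[B_1+1]\times\cdots\times[B_J+1]$, where $s_j$ is the number of customers at station $j$. $\Pi$ is the set of all pricing policies, i.e. functions $\pi:\mathcal{S}\to\mathcal{A}$, $\pi(\mathbf{s})$ being the price quoted in state $\mathbf{s}$. $\Pi_{\mathrm{STATIC}}\subset\Pi$ is the set of static (constant) policies $\pi_a$, $\pi_a(\mathbf{s})=a$ for all $\mathbf{s}$, with $a\in\mathcal{A}$. Under $\pi$ the state process $\{\mathbf{X}^\pi(t)\}_{t\ge 0}$ is the continuous-time Markov chain on $\mathcal{S}$ whose transition rates from $\mathbf{s}$ to $\mathbf{s}'\in\mathcal{S}$, $\mathbf{s}'\ne\mathbf{s}$,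 are: $\lambda(1-F(\pi(\mathbf{s})-))$ if $\mathbf{s}'=\mathbf{s}+\mathbf{e}_1$; $\mu_j$ if $\mathbf{s}'=\mathbf{s}-\mathbf{e}_j+\mathbf{e}_{j+1}$ with $1\le j\le J-1$; $\mu_J$ if $\mathbf{s}'=\mathbf{s}-\mathbf{e}_J$; and $0$ otherwise. Gain: let $R^\pi(\mathbf{s},\mathbf{s}')=\pi(\mathbf{s})$ if $\mathbf{s}'=\mathbf{s}+\mathbf{e}_1$ and $0$ otherwise; let $T^\pi_0=0$ and let $T_1^\pi<T_2^\pi<\cdots$ be the successive jump times of $\mathbf{X}^\pi$. The gain (long-run expected time-average revenue) is $$g^\pi(B_1,\dots,B_J):=\lim_{T\to\infty}\frac1T\,\mathbb{E}\Big[\sum_{n\ge1:\,T_n^\pi\le T}R^\pi\big(\mathbf{X}^\pi(T^\pi_{n-1}),\mathbf{X}^\pi(T^\pi_n)\big)\Big],$$ which exists and does not depend on the initial state. *)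

theory Defs
  imports "HOL-Probability.Probability"
begin

section \<open>Finite-state continuous-time Markov chains\<close>

text \<open>
  A chain on a finite set \<open>S\<close> with off-diagonal transition rates \<open>q\<close> (so \<open>q s s = 0\<close>) and
  positive exit rates is constructed from its jump chain and its holding times: from \<open>s\<close> the
  next state is \<open>s'\<close> with probability \<open>q s s' / exit_rate S q s\<close>, independently of the holding
  time in \<open>s\<close>, which is exponential with rate \<open>exit_rate S q s\<close>.

  The underlying sample space is a sequence of independent families, one for each step number;
  a family holds, for each state \<open>s\<close>, an independent pair (next state, holding time) with the law
  above. In step \<open>n\<close> the chain uses only the pair that belongs to its current state, so that given
  the past this pair has the law prescribed by the current state.
\<close>

definition exit_rate :: "'a set \<Rightarrow> ('a \<Rightarrow> 'a \<Rightarrow> real) \<Rightarrow> 'a \<Rightarrow> real" where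
  "exit_rate S q s = (\<Sum>s'\<in>S. q s s')"

definition step_law :: "'a set \<Rightarrow> ('a \<Rightarrow> 'a \<Rightarrow> real) \<Rightarrow> 'a \<Rightarrow> ('a \<times> real) measure" where
  "step_law S q s =
     point_measure S (\<lambda>s'. ennreal (q s s' / exit_rate S q s))
       \<Otimes>\<^sub>M density lborel (\<lambda>t. ennreal (exponential_density (exit_rate S q s) t))"

definition ctmc_space :: "'a set \<Rightarrow> ('a \<Rightarrow> 'a \<Rightarrow> real) \<Rightarrow> ('a \<Rightarrow> 'a \<times> real) stream measure" where
  "ctmc_space S q = stream_space (\<Pi>\<^sub>M s\<in>S. step_law S q s)"

primrec jump_chain :: "'a \<Rightarrow> ('a \<Rightarrow> 'a \<times> real) stream \<Rightarrow> nat \<Rightarrow> 'a" where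
  "jump_chain s0 \<omega> 0 = s0"
| "jump_chain s0 \<omega> (Suc n) = fst ((\<omega> !! n) (jump_chain s0 \<omega> n))"

definition jump_time :: "'a \<Rightarrow> ('a \<Rightarrow> 'a \<times> real) stream \<Rightarrow> nat \<Rightarrow> real" where
  "jump_time s0 \<omega> n = (\<Sum>k<n. snd ((\<omega> !! k) (jump_chain s0 \<omega> k)))"

text \<open>
  The state at time \<open>t\<close>, for the chain started in \<open>s0\<close>. Almost surely the jump times strictly
  increase to infinity, so that the minimum is over a nonempty set.
\<close>

definition ctmc :: "'a \<Rightarrow> ('a \<Rightarrow> 'a \<times> real) stream \<Rightarrow> real \<Rightarrow> 'a" where
  "ctmc s0 \<omega> t = jump_chain s0 \<omega> (LEAST n. t < jump_time s0 \<omega> (Suc n))"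


section \<open>The tandem queue\<close>

text \<open>
  States, buffer sizes and service rates are functions on \<open>nat\<close> of which only the values at the
  stations \<open>1, \<dots>, J\<close> matter; states and policies are extensional, so that \<open>state_space J B\<close> is
  finite and a policy is nothing but its values on the state space.
\<close>

type_synonym state = "nat \<Rightarrow> nat"
type_synonym policy = "state \<Rightarrow> real"

definition state_space :: "nat \<Rightarrow> (nat \<Rightarrow> nat) \<Rightarrow> state set" where
  "state_space J B = (\<Pi>\<^sub>E j\<in>{1..J}. {0..B j + 1})"

definition policies :: "nat \<Rightarrow> (nat \<Rightarrow> nat) \<Rightarrow> real set \<Rightarrow> policy set" where
  "policies J B A = (state_space J B \<rightarrow>\<^sub>E A)"

definition static_policy :: "nat \<Rightarrow> (nat \<Rightarrow> nat) \<Rightarrow> real \<Rightarrow> policy" where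
  "static_policy J B a = (\<lambda>s\<in>state_space J B. a)"

definition static_policies :: "nat \<Rightarrow> (nat \<Rightarrow> nat) \<Rightarrow> real set \<Rightarrow> policy set" where
  "static_policies J B A = static_policy J B ` A"

definition left_lim :: "(real \<Rightarrow> real) \<Rightarrow> real \<Rightarrow> real" where
  "left_lim F a = Lim (at_left a) F"

definition arrive :: "state \<Rightarrow> state" where
  "arrive s = s(1 := s 1 + 1)"

definition serve :: "nat \<Rightarrow> nat \<Rightarrow> state \<Rightarrow> state" where
  "serve J j s =
     (if j < J then s(j := s j - 1, j + 1 := s (j + 1) + 1) else s(j := s j - 1))"

text \<open>
  Subtraction on \<open>nat\<close> is truncated, hence the guard \<open>0 < s j\<close>. The states \<open>arrive s\<close> and
  \<open>serve J j s\<close> with \<open>0 < s j\<close> are pairwise distinct and distinct from \<open>s\<close>, so that at most one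
  summand is nonzero. Rates are only ever used for targets \<open>s'\<close> in the state space; this is what
  makes arrivals at a full station 1 lost and blocks station \<open>j\<close> while station \<open>j + 1\<close> is full.
\<close>

definition queue_rate ::
  "nat \<Rightarrow> (nat \<Rightarrow> real) \<Rightarrow> real \<Rightarrow> (real \<Rightarrow> real) \<Rightarrow> policy \<Rightarrow> state \<Rightarrow> state \<Rightarrow> real" where
  "queue_rate J \<mu> \<Lambda> F \<pi> s s' =
     (if s' = arrive s then \<Lambda> * (1 - left_lim F (\<pi> s)) else 0)
     + (\<Sum>j\<in>{1..J}. if 0 < s j \<and> s' = serve J j s then \<mu> j else 0)"

definition reward :: "policy \<Rightarrow> state \<Rightarrow> state \<Rightarrow> real" where
  "reward \<pi> s s' = (if s' = arrive s then \<pi> s else 0)"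

text \<open>Almost surely only finitely many jump times are at most \<open>T\<close>.\<close>

definition expected_revenue ::
  "nat \<Rightarrow> (nat \<Rightarrow> real) \<Rightarrow> real \<Rightarrow> (real \<Rightarrow> real) \<Rightarrow> (nat \<Rightarrow> nat) \<Rightarrow> policy \<Rightarrow> state \<Rightarrow> real \<Rightarrow> real"
where
  "expected_revenue J \<mu> \<Lambda> F B \<pi> s0 T =
     (\<integral>\<omega>. (\<Sum>n | 1 \<le> n \<and> jump_time s0 \<omega> n \<le> T.
             reward \<pi> (ctmc s0 \<omega> (jump_time s0 \<omega> (n - 1))) (ctmc s0 \<omega> (jump_time s0 \<omega> n)))
        \<partial>ctmc_space (state_space J B) (queue_rate J \<mu> \<Lambda> F \<pi>))"

text \<open>The common limit for all initial states.\<close>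

definition gain ::
  "nat \<Rightarrow> (nat \<Rightarrow> real) \<Rightarrow> real \<Rightarrow> (real \<Rightarrow> real) \<Rightarrow> (nat \<Rightarrow> nat) \<Rightarrow> policy \<Rightarrow> real" where
  "gain J \<mu> \<Lambda> F B \<pi> =
     (THE g. \<forall>s0\<in>state_space J B.
        ((\<lambda>T. 1 / T * expected_revenue J \<mu> \<Lambda> F B \<pi> s0 T) \<longlongrightarrow> g) at_top)"

end

theory Submission
  imports Defs
begin

text \<open>
  If \<open>g \<le> \<Sum> q s s' (r s s' + h s' - h s)\<close> holds at every state \<open>s\<close>, then \<open>g\<close> is a lower bound for the
  long-run average reward, and likewise with \<open>\<ge>\<close> and upper bounds: first-step analysis bounds the
  expected reward up to time \<open>T\<close> by \<open>g T\<close> up to a constant. The limit itself exists because the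
  equation (Poisson's equation) is solvable, which follows from a Lyapunov function.

  With \<open>h = 0\<close> every policy has gain at most the maximal revenue rate \<open>a\<^sub>s \<alpha>\<close>. For the static policy
  the loss is \<open>a\<^sub>s \<alpha>\<close> times the probability that station 1 is full. The workload \<open>W\<close>, the
  expected total service time still owed to the customers present, decreases at rate at least 1 as
  long as anyone is present, because some server is always active, and increases at rate at most
  \<open>\<alpha> \<Sum> 1 / \<mu> j < 1\<close>. So \<open>exp (\<theta> W)\<close> has geometric drift for small \<open>\<theta>\<close>, uniformly in the buffer
  sizes, and its stationary mean is bounded; since \<open>W \<ge> (B 1 + 1) \<Sum> 1 / \<mu> j\<close> when station 1 is
  full, that probability is exponentially small in \<open>B 1\<close>.
\<close>

section \<open>First-step analysis of the accumulated reward\<close>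

text \<open>Reward of the jumps among the first \<open>n\<close> that occur by time
  \<open>T\<close>. The recursion peels off one step and restarts with the remaining time and the
  tail of the stream, so that first-step analysis becomes induction on \<open>n\<close>. Values in
  \<open>ennreal\<close> allow monotone convergence before any integrability is known.\<close>

primrec revenue :: "('a \<Rightarrow> 'a \<Rightarrow> real) \<Rightarrow> nat \<Rightarrow> 'a \<Rightarrow> real \<Rightarrow> ('a \<Rightarrow> 'a \<times> real) stream \<Rightarrow> ennreal" where
  "revenue r 0 s T \<omega> = 0"
| "revenue r (Suc n) s T \<omega> =
     (if snd (shd \<omega> s) \<le> T
      then ennreal (r s (fst (shd \<omega> s))) + revenue r n (fst (shd \<omega> s)) (T - snd (shd \<omega> s)) (stl \<omega>)
      else 0)"

lemma jump_chain_Suc_shift: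
  "jump_chain s \<omega> (Suc n) = jump_chain (fst (shd \<omega> s)) (stl \<omega>) n"
  by (induction n) auto

lemma jump_time_Suc_shift:
  "jump_time s \<omega> (Suc n) = snd (shd \<omega> s) + jump_time (fst (shd \<omega> s)) (stl \<omega>) n"
  unfolding jump_time_def sum.lessThan_Suc_shift
  by (simp only: jump_chain_Suc_shift jump_chain.simps(1) snth.simps)

text \<open>\<open>ennreal\<close> truncates at 0, so the right-hand side integrates the positive
  part of \<open>f\<close>. Lower bounds whose integrand may change sign pass to
  \<open>nn_integral\<close> in this way.\<close>

lemma ennreal_integral_le_nn_integral:
  fixes f :: "'a \<Rightarrow> real"
  assumes "integrable M f"
  shows "ennreal (\<integral>x. f x \<partial>M) \<le> (\<integral>\<^sup>+x. ennreal (f x) \<partial>M)"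
proof -
  have "(\<integral>x. f x \<partial>M) \<le> (\<integral>x. max 0 (f x) \<partial>M)"
    using assms by (intro integral_mono) auto
  also have "ennreal \<dots> = (\<integral>\<^sup>+x. ennreal (max 0 (f x)) \<partial>M)"
    using assms by (intro nn_integral_eq_integral[symmetric]) auto
  also have "\<dots> = (\<integral>\<^sup>+x. ennreal (f x) \<partial>M)"
    by (intro nn_integral_cong) (auto simp: max_def ennreal_neg)
  finally show ?thesis
    by (simp add: ennreal_leI)
qed

text \<open>The same truncation for sums: negative terms lower the left-hand side only.\<close>

lemma ennreal_sum_le: "ennreal (\<Sum>i\<in>I. f i) \<le> (\<Sum>i\<in>I. ennreal (f i))"
proof (cases "finite I")
  case True
  have "(\<Sum>i\<in>I. f i) \<le> (\<Sum>i\<in>I. max 0 (f i))"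
    by (intro sum_mono) simp
  then have "ennreal (\<Sum>i\<in>I. f i) \<le> ennreal (\<Sum>i\<in>I. max 0 (f i))"
    by (rule ennreal_leI)
  also have "\<dots> = (\<Sum>i\<in>I. ennreal (max 0 (f i)))"
    by (intro sum_ennreal[symmetric]) simp
  also have "\<dots> = (\<Sum>i\<in>I. ennreal (f i))"
    by (intro sum.cong refl) (auto simp: max_def ennreal_neg)
  finally show ?thesis .
qed simp

lemma revenue_mono_Suc: "revenue r n s T \<omega> \<le> revenue r (Suc n) s T \<omega>"
proof (induction n arbitrary: s T \<omega>)
  case (Suc n)
  show ?case
    using Suc.IH[of "fst (shd \<omega> s)" "T - snd (shd \<omega> s)" "stl \<omega>"]
    by (auto intro!: add_left_mono
        simp del: revenue.simps(2) simp: revenue.simps(2)[of r n s] revenue.simps(2)[of r "Suc n" s])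
qed simp

lemma incseq_revenue: "incseq (\<lambda>n. revenue r n s T \<omega>)"
  by (intro incseq_SucI revenue_mono_Suc)

section \<open>Step laws and measurability for a finite chain\<close>

locale finite_chain =
  fixes S :: "'a set" and q :: "'a \<Rightarrow> 'a \<Rightarrow> real"
  assumes finite_states: "finite S"
    and rate_nonneg: "\<And>s s'. s \<in> S \<Longrightarrow> s' \<in> S \<Longrightarrow> 0 \<le> q s s'"
    and exit_rate_pos: "\<And>s. s \<in> S \<Longrightarrow> 0 < exit_rate S q s"
begin

abbreviation "step_space \<equiv> \<Pi>\<^sub>M s\<in>S. step_law S q s"
abbreviation "path_space \<equiv> stream_space step_space"

lemma jump_prob_sum: "s \<in> S \<Longrightarrow> (\<Sum>s'\<in>S. q s s' / exit_rate S q s) = 1"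
  using exit_rate_pos[of s] by (simp add: sum_divide_distrib[symmetric] exit_rate_def)

lemma jump_prob_nonneg: "s \<in> S \<Longrightarrow> s' \<in> S \<Longrightarrow> 0 \<le> q s s' / exit_rate S q s"
  using exit_rate_pos[of s] rate_nonneg[of s s'] by simp

lemma prob_space_jump_law:
  assumes "s \<in> S"
  shows "prob_space (point_measure S (\<lambda>s'. ennreal (q s s' / exit_rate S q s)))"
proof -
  have "(\<Sum>s'\<in>S. ennreal (q s s' / exit_rate S q s)) = ennreal (\<Sum>s'\<in>S. q s s' / exit_rate S q s)"
    using assms by (intro sum_ennreal jump_prob_nonneg)
  then show ?thesis
    using finite_states jump_prob_sum[OF assms] by (intro prob_space_point_measure) auto
qed

lemma prob_space_step_law: "s \<in> S \<Longrightarrow> prob_space (step_law S q s)"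
  unfolding step_law_def
  by (intro prob_space_pair prob_space_jump_law prob_space_exponential_density exit_rate_pos)

lemma prob_space_step_space: "prob_space step_space"
  by (intro prob_space_PiM prob_space_step_law)

lemma prob_space_path_space: "prob_space path_space"
  by (rule prob_space.prob_space_stream_space[OF prob_space_step_space])

lemma sets_step_law: "sets (step_law S q s) = sets (count_space S \<Otimes>\<^sub>M borel)"
  unfolding step_law_def
  by (intro sets_pair_measure_cong) (auto simp: sets_point_measure)

lemma space_step_law: "space (step_law S q s) = S \<times> UNIV"
  using sets_eq_imp_space_eq[OF sets_step_law] by (simp add: space_pair_measure)

text \<open>Fubini for the product law; the integral over the discrete coordinate is a finite
  sum.\<close>

lemma nn_integral_step_law:
  assumes "s \<in> S" and f: "f \<in> borel_measurable (step_law S q s)"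
  shows "(\<integral>\<^sup>+y. f y \<partial>step_law S q s) =
    (\<integral>\<^sup>+t. ennreal (exponential_density (exit_rate S q s) t) *
       (\<Sum>s'\<in>S. ennreal (q s s' / exit_rate S q s) * f (s', t)) \<partial>lborel)"
proof -
  let ?P = "point_measure S (\<lambda>s'. ennreal (q s s' / exit_rate S q s))"
  let ?E = "density lborel (\<lambda>t. ennreal (exponential_density (exit_rate S q s) t))"
  interpret P: prob_space ?P by (rule prob_space_jump_law[OF assms(1)])
  interpret E: prob_space ?E by (intro prob_space_exponential_density exit_rate_pos assms)
  interpret PE: pair_sigma_finite ?P ?E ..
  have m: "(\<lambda>t. f (s', t)) \<in> borel_measurable borel" if "s' \<in> S" for s'
  proof -
    have "(\<lambda>t. (s', t)) \<in> borel \<rightarrow>\<^sub>M count_space S \<Otimes>\<^sub>M borel"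
      using that by simp
    from measurable_compose[OF this] f show ?thesis
      by (simp add: measurable_cong_sets[OF sets_step_law refl])
  qed
  have "(\<integral>\<^sup>+y. f y \<partial>step_law S q s) = (\<integral>\<^sup>+t. (\<integral>\<^sup>+s'. f (s', t) \<partial>?P) \<partial>?E)"
    using f unfolding step_law_def by (intro PE.nn_integral_snd[symmetric])
  also have "\<dots> = (\<integral>\<^sup>+t. (\<Sum>s'\<in>S. ennreal (q s s' / exit_rate S q s) * f (s', t)) \<partial>?E)"
    using finite_states by (simp add: nn_integral_point_measure_finite mult.commute)
  also have "\<dots> = (\<integral>\<^sup>+t. ennreal (exponential_density (exit_rate S q s) t) *
       (\<Sum>s'\<in>S. ennreal (q s s' / exit_rate S q s) * f (s', t)) \<partial>lborel)"
    using m by (intro nn_integral_density) auto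
  finally show ?thesis .
qed

lemma nn_integral_step_space:
  assumes "s \<in> S" and f: "f \<in> borel_measurable (step_law S q s)"
  shows "(\<integral>\<^sup>+x. f (x s) \<partial>step_space) = (\<integral>\<^sup>+y. f y \<partial>step_law S q s)"
proof -
  have "(\<integral>\<^sup>+y. f y \<partial>step_law S q s) = (\<integral>\<^sup>+y. f y \<partial>distr step_space (step_law S q s) (\<lambda>x. x s))"
    by (subst distr_PiM_component) (auto intro: prob_space_step_law assms)
  also have "\<dots> = (\<integral>\<^sup>+x. f (x s) \<partial>step_space)"
    using assms by (intro nn_integral_distr) auto
  finally show ?thesis ..
qed

lemma measurable_fst_step [measurable]:
  assumes "s \<in> S" shows "(\<lambda>x. fst (x s)) \<in> step_space \<rightarrow>\<^sub>M count_space S"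
proof -
  have [measurable]: "fst \<in> step_law S q s \<rightarrow>\<^sub>M count_space S"
    by (simp add: measurable_cong_sets[OF sets_step_law refl])
  show ?thesis
    using assms by measurable
qed

lemma measurable_snd_step [measurable]:
  assumes "s \<in> S" shows "(\<lambda>x. snd (x s)) \<in> borel_measurable step_space"
proof -
  have [measurable]: "snd \<in> step_law S q s \<rightarrow>\<^sub>M borel"
    by (simp add: measurable_cong_sets[OF sets_step_law refl])
  show ?thesis
    using assms by measurable
qed

text \<open>Measurability must be joint in \<open>T\<close> and the path, because the recursion
  replaces \<open>T\<close> by the random remaining time.\<close>

lemma measurable_revenue:
  "s \<in> S \<Longrightarrow> (\<lambda>(T, \<omega>). revenue r n s T \<omega>) \<in> borel_measurable (borel \<Otimes>\<^sub>M path_space)"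
proof (induction n arbitrary: s)
  case 0
  then show ?case by simp
next
  case (Suc n)
  have IH [measurable]: "(\<lambda>(T, \<omega>). revenue r n s' T \<omega>) \<in> borel_measurable (borel \<Otimes>\<^sub>M path_space)" if "s' \<in> S" for s'
    by (rule Suc.IH[OF that])
  have m1 [measurable]: "(\<lambda>p :: real \<times> _. fst (shd (snd p) s)) \<in> borel \<Otimes>\<^sub>M path_space \<rightarrow>\<^sub>M count_space S"
    using Suc.prems by measurable
  have m2 [measurable]: "(\<lambda>p :: real \<times> _. snd (shd (snd p) s)) \<in> borel_measurable (borel \<Otimes>\<^sub>M path_space)"
    using Suc.prems by measurable
  have "(\<lambda>p :: real \<times> _. ennreal (r s s') + revenue r n s' (fst p - snd (shd (snd p) s)) (stl (snd p)))
      \<in> borel_measurable (borel \<Otimes>\<^sub>M path_space)" if "s' \<in> S" for s'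
  proof -
    have "(\<lambda>p :: real \<times> _. (fst p - snd (shd (snd p) s), stl (snd p)))
       \<in> borel \<Otimes>\<^sub>M path_space \<rightarrow>\<^sub>M borel \<Otimes>\<^sub>M path_space"
      by measurable
    from measurable_compose[OF this IH[OF that]] show ?thesis by simp
  qed
  \<comment> \<open>The next state is random but takes finitely many values, so measurability for
    each fixed \<open>s'\<close> suffices.\<close>
  note [measurable] = measurable_compose_countable'[OF this m1 countable_finite[OF finite_states], simplified]
  show ?case by (simp add: case_prod_unfold)
qed

lemma measurable_revenue_path [measurable]:
  assumes "s \<in> S" shows "revenue r n s T \<in> borel_measurable path_space"
  using measurable_compose[OF measurable_Pair1'[of T borel path_space] measurable_revenue[OF assms, of r n]]
  by simp

section \<open>The renewal equation for the mean revenue, with upper and lower solutions\<close>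

definition mean_revenue :: "('a \<Rightarrow> 'a \<Rightarrow> real) \<Rightarrow> nat \<Rightarrow> 'a \<Rightarrow> real \<Rightarrow> ennreal" where
  "mean_revenue r n s T = (\<integral>\<^sup>+\<omega>. revenue r n s T \<omega> \<partial>path_space)"

lemma measurable_mean_revenue [measurable]:
  assumes "s \<in> S" shows "mean_revenue r n s \<in> borel_measurable borel"
proof -
  interpret prob_space path_space by (rule prob_space_path_space)
  show ?thesis
    unfolding mean_revenue_def
    using borel_measurable_nn_integral[of "revenue r n s" borel] measurable_revenue[OF assms, of r n]
    by simp
qed

lemma mean_revenue_0: "mean_revenue r 0 s T = 0"
  by (simp add: mean_revenue_def)

text \<open>Conditioning on the first step: the tail of the stream is independent of it and has the
  law of the whole stream, so after a jump to \<open>s'\<close> at time \<open>t\<close> the mean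
  revenue restarts there with horizon \<open>T - t\<close>.\<close>

lemma mean_revenue_Suc:
  assumes s: "s \<in> S"
  shows "mean_revenue r (Suc n) s T =
    (\<integral>\<^sup>+t. ennreal (exponential_density (exit_rate S q s) t) *
       (\<Sum>s'\<in>S. ennreal (q s s' / exit_rate S q s) *
         (if t \<le> T then ennreal (r s s') + mean_revenue r n s' (T - t) else 0)) \<partial>lborel)"
proof -
  interpret P: prob_space path_space by (rule prob_space_path_space)
  let ?f = "\<lambda>y. if snd y \<le> T then ennreal (r s (fst y)) + mean_revenue r n (fst y) (T - snd y) else 0"
  have f: "?f \<in> borel_measurable (step_law S q s)"
  proof -
    have "(\<lambda>y. ennreal (r s s') + mean_revenue r n s' (T - snd y)) \<in> borel_measurable (count_space S \<Otimes>\<^sub>M borel)"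
      if "s' \<in> S" for s'
      using that by measurable
    note [measurable] = measurable_compose_countable'[OF this measurable_fst countable_finite[OF finite_states], simplified]
    show ?thesis
      unfolding measurable_cong_sets[OF sets_step_law refl] by measurable
  qed
  have "mean_revenue r (Suc n) s T =
    (\<integral>\<^sup>+x. (\<integral>\<^sup>+\<omega>. revenue r (Suc n) s T (x ## \<omega>) \<partial>path_space) \<partial>step_space)"
    unfolding mean_revenue_def
    by (intro prob_space.nn_integral_stream_space[OF prob_space_step_space] measurable_revenue_path s)
  also have "\<dots> = (\<integral>\<^sup>+x. ?f (x s) \<partial>step_space)"
  proof (intro nn_integral_cong)
    fix x assume "x \<in> space step_space"
    then have "x s \<in> space (step_law S q s)"
      using s by (auto simp: space_PiM)
    then have "fst (x s) \<in> S"
      by (auto simp: space_step_law)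
    then show "(\<integral>\<^sup>+\<omega>. revenue r (Suc n) s T (x ## \<omega>) \<partial>path_space) = ?f (x s)"
      by (auto simp: mean_revenue_def nn_integral_add P.emeasure_space_1)
  qed
  also have "\<dots> = (\<integral>\<^sup>+y. ?f y \<partial>step_law S q s)"
    by (rule nn_integral_step_space[OF s f])
  finally show ?thesis
    unfolding nn_integral_step_law[OF s f] fst_conv snd_conv .
qed

text \<open>Passes between the generator, in which the hypotheses are stated, and the jump
  probabilities, which appear in the renewal equation.\<close>

lemma generator_eq:
  assumes "s \<in> S"
  shows "(\<Sum>s'\<in>S. q s s' * (f s' - h s)) =
    exit_rate S q s * ((\<Sum>s'\<in>S. q s s' / exit_rate S q s * f s') - h s)"
proof -
  have "(\<Sum>s'\<in>S. q s s' * (f s' - h s)) = (\<Sum>s'\<in>S. q s s' * f s') - exit_rate S q s * h s"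
    by (simp add: right_diff_distrib sum_subtractf sum_distrib_right exit_rate_def)
  moreover have "exit_rate S q s * (\<Sum>s'\<in>S. q s s' / exit_rate S q s * f s') = (\<Sum>s'\<in>S. q s s' * f s')"
    using exit_rate_pos[OF assms] by (simp add: sum_distrib_left)
  ultimately show ?thesis
    by (simp add: right_diff_distrib)
qed

lemma jump_sum_affine:
  assumes "s \<in> S"
  shows "(\<Sum>s'\<in>S. q s s' / exit_rate S q s * (f s' + c)) = (\<Sum>s'\<in>S. q s s' / exit_rate S q s * f s') + c"
  using jump_prob_sum[OF assms]
  by (simp add: distrib_left sum.distrib sum_distrib_right[symmetric] del: times_divide_eq_left)

lemma mean_revenue_le:
  assumes r: "\<And>s s'. s \<in> S \<Longrightarrow> s' \<in> S \<Longrightarrow> 0 \<le> r s s'"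
    and g: "0 \<le> g" and h: "\<And>s. s \<in> S \<Longrightarrow> 0 \<le> h s"
    and super: "\<And>s. s \<in> S \<Longrightarrow> (\<Sum>s'\<in>S. q s s' * (r s s' + h s' - h s)) \<le> g"
  shows "s \<in> S \<Longrightarrow> 0 \<le> T \<Longrightarrow> mean_revenue r n s T \<le> ennreal (g * T + h s)"
proof (induction n arbitrary: s T)
  case 0
  then show ?case by (simp add: mean_revenue_0)
next
  case (Suc n)
  note s = \<open>s \<in> S\<close> and T = \<open>0 \<le> T\<close>
  define l where "l = exit_rate S q s"
  have l: "0 < l" using exit_rate_pos[OF s] by (simp add: l_def)
  let ?P = "\<lambda>s'. q s s' / exit_rate S q s"
  have "l * ((\<Sum>s'\<in>S. ?P s' * (r s s' + h s')) - h s) \<le> g"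
    using super[OF s] generator_eq[OF s, of "\<lambda>s'. r s s' + h s'" h] by (simp add: l_def)
  then have mean: "(\<Sum>s'\<in>S. ?P s' * (r s s' + h s')) \<le> h s + g / l"
    using l by (simp add: field_simps)
  let ?f = "\<lambda>t. l * exp (- l * t) * (h s + g / l + g * (T - t))"
  \<comment> \<open>An antiderivative of \<open>?f\<close>; differentiating the linear factor
    produces the summand \<open>g / l\<close>.\<close>
  let ?F = "\<lambda>t. - exp (- l * t) * (h s + g * (T - t))"
  have "mean_revenue r (Suc n) s T \<le> (\<integral>\<^sup>+t. ennreal (?f t) * indicator {0..T} t \<partial>lborel)"
    unfolding mean_revenue_Suc[OF s]
  proof (intro nn_integral_mono)
    fix t :: real
    show "ennreal (exponential_density (exit_rate S q s) t) *
       (\<Sum>s'\<in>S. ennreal (?P s') * (if t \<le> T then ennreal (r s s') + mean_revenue r n s' (T - t) else 0))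
       \<le> ennreal (?f t) * indicator {0..T} t"
    proof (cases "0 \<le> t \<and> t \<le> T")
      case True
      then have gT: "0 \<le> g * (T - t)"
        using g by simp
      have "(\<Sum>s'\<in>S. ennreal (?P s') * (ennreal (r s s') + mean_revenue r n s' (T - t)))
        \<le> (\<Sum>s'\<in>S. ennreal (?P s' * (r s s' + h s' + g * (T - t))))"
      proof (intro sum_mono)
        fix s' assume s': "s' \<in> S"
        have "ennreal (r s s') + mean_revenue r n s' (T - t) \<le> ennreal (r s s') + ennreal (g * (T - t) + h s')"
          using True s' by (intro add_left_mono Suc.IH) auto
        also have "\<dots> = ennreal (r s s' + h s' + g * (T - t))"
          using gT r[OF s s'] h[OF s'] by (subst ennreal_plus[symmetric]) (auto simp: add_ac)
        finally show "ennreal (?P s') * (ennreal (r s s') + mean_revenue r n s' (T - t))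
            \<le> ennreal (?P s' * (r s s' + h s' + g * (T - t)))"
          using jump_prob_nonneg[OF s s'] True s' r[OF s s'] h[OF s'] g
          by (subst ennreal_mult) (auto intro!: mult_left_mono)
      qed
      also have "\<dots> = ennreal (\<Sum>s'\<in>S. ?P s' * (r s s' + h s' + g * (T - t)))"
      proof (intro sum_ennreal)
        fix s' assume s': "s' \<in> S"
        show "0 \<le> ?P s' * (r s s' + h s' + g * (T - t))"
          using jump_prob_nonneg[OF s s'] True s' r[OF s s'] h[OF s'] g
          by (intro mult_nonneg_nonneg) auto
      qed
      also have "\<dots> \<le> ennreal (h s + g / l + g * (T - t))"
        using mean by (intro ennreal_leI) (simp only: jump_sum_affine[OF s] add_right_mono)
      finally have "ennreal (l * exp (- l * t)) *
          (\<Sum>s'\<in>S. ennreal (?P s') * (ennreal (r s s') + mean_revenue r n s' (T - t)))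
          \<le> ennreal (l * exp (- l * t)) * ennreal (h s + g / l + g * (T - t))"
        by (intro mult_left_mono) auto
      also have "\<dots> = ennreal (?f t)"
        using l True h[OF s] g by (intro ennreal_mult[symmetric]) auto
      finally show ?thesis
        using True by (simp add: exponential_density_def l_def mult.commute)
    qed (auto simp: exponential_density_def)
  qed
  also have "\<dots> = ennreal (?F T - ?F 0)"
  proof (rule nn_integral_FTC_Icc)
    fix t assume t: "t \<in> {0..T}"
    show "(?F has_real_derivative ?f t) (at t)"
      using l by (auto intro!: derivative_eq_intros simp: field_simps)
    show "0 \<le> ?f t"
      using t l h[OF s] g by (intro mult_nonneg_nonneg) auto
  qed (use T in auto)
  also have "\<dots> \<le> ennreal (g * T + h s)"
    using h[OF s] by (intro ennreal_leI) (simp add: algebra_simps)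
  finally show ?case .
qed

text \<open>The mirror image of the upper bound, now with \<open>h\<close> nonpositive so that the
  boundary term has the right sign. Cutting off after \<open>n\<close> jumps costs
  \<open>g * \<rho> ^ n * exp T\<close>: at \<open>n = 0\<close> this exceeds \<open>g * T\<close>,
  and each jump contributes a factor at most \<rho>, because a holding time of rate \<open>l\<close>
  has Laplace transform \<open>l / (l + 1)\<close> at 1.\<close>

lemma mean_revenue_ge:
  assumes r: "\<And>s s'. s \<in> S \<Longrightarrow> s' \<in> S \<Longrightarrow> 0 \<le> r s s'"
    and g: "0 \<le> g" and h: "\<And>s. s \<in> S \<Longrightarrow> h s \<le> 0"
    and rho: "\<And>s. s \<in> S \<Longrightarrow> exit_rate S q s / (exit_rate S q s + 1) \<le> \<rho>"
    and sub: "\<And>s. s \<in> S \<Longrightarrow> g \<le> (\<Sum>s'\<in>S. q s s' * (r s s' + h s' - h s))"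
  shows "s \<in> S \<Longrightarrow> 0 \<le> T \<Longrightarrow> ennreal (g * T + h s - g * \<rho> ^ n * exp T) \<le> mean_revenue r n s T"
proof (induction n arbitrary: s T)
  case 0
  have "T \<le> exp T"
    using exp_ge_add_one_self[of T] by linarith
  then have "g * T \<le> g * exp T"
    using g by (rule mult_left_mono)
  then show ?case
    using h[OF 0(1)] by (simp add: mean_revenue_0 ennreal_neg)
next
  case (Suc n)
  note s = \<open>s \<in> S\<close> and T = \<open>0 \<le> T\<close>
  define l where "l = exit_rate S q s"
  have l: "0 < l" using exit_rate_pos[OF s] by (simp add: l_def)
  \<comment> \<open>The mean of \<open>exp (- t)\<close> for an exponential time \<open>t\<close> of
    rate \<open>l\<close>.\<close>
  define k where "k = l / (l + 1)"
  have k: "0 \<le> k" "k * (l + 1) = l" "k \<le> \<rho>"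
    using l rho[OF s] by (simp_all add: k_def l_def)
  then have rho0: "0 \<le> \<rho>" by linarith
  let ?P = "\<lambda>s'. q s s' / exit_rate S q s"
  have "g \<le> l * ((\<Sum>s'\<in>S. ?P s' * (r s s' + h s')) - h s)"
    using sub[OF s] generator_eq[OF s, of "\<lambda>s'. r s s' + h s'" h] by (simp add: l_def)
  then have mean: "h s + g / l \<le> (\<Sum>s'\<in>S. ?P s' * (r s s' + h s'))"
    using l by (simp add: field_simps)
  let ?c = "\<lambda>t. g * (T - t) - g * \<rho> ^ n * exp (T - t)"
  let ?f = "\<lambda>t. l * exp (- l * t) * (h s + g / l + ?c t)"
  let ?F = "\<lambda>t. - exp (- l * t) * (h s + g * (T - t)) + g * \<rho> ^ n * k * exp (T - (l + 1) * t)"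
  have FTC: "has_bochner_integral lborel (\<lambda>t. ?f t * indicator {0..T} t) (?F T - ?F 0)"
  proof (rule has_bochner_integral_FTC_Icc_real)
    fix t assume t: "0 \<le> t" "t \<le> T"
    have e: "exp (T - (l + 1) * t) = exp (- l * t) * exp (T - t)"
      by (simp add: exp_add[symmetric] algebra_simps)
    have "(?F has_real_derivative
       (l * exp (- l * t) * (h s + g * (T - t)) + exp (- l * t) * g
         - g * \<rho> ^ n * (k * (l + 1)) * exp (T - (l + 1) * t))) (at t)"
      by (auto intro!: derivative_eq_intros simp: algebra_simps)
    also have "l * exp (- l * t) * (h s + g * (T - t)) + exp (- l * t) * g
         - g * \<rho> ^ n * (k * (l + 1)) * exp (T - (l + 1) * t) = ?f t"
      unfolding e k using l by (simp add: field_simps)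
    finally show "(?F has_real_derivative ?f t) (at t)" .
    show "isCont ?f t"
      by (intro continuous_intros)
  qed (use T in auto)
  have "g * T + h s - g * \<rho> ^ Suc n * exp T \<le> ?F T - ?F 0"
  proof -
    have "exp (- l * T) * h s \<le> 0"
      using h[OF s] by (simp add: mult_nonneg_nonpos)
    moreover have "0 \<le> g * \<rho> ^ n * k * exp (T - (l + 1) * T)"
      using g k rho0 by (intro mult_nonneg_nonneg) auto
    moreover have "g * \<rho> ^ n * k * exp T \<le> g * \<rho> ^ n * \<rho> * exp T"
      using g rho0 by (intro mult_right_mono mult_left_mono k) auto
    ultimately show ?thesis
      by (simp add: algebra_simps)
  qed
  then have "ennreal (g * T + h s - g * \<rho> ^ Suc n * exp T) \<le> ennreal (\<integral>t. ?f t * indicator {0..T} t \<partial>lborel)"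
    using has_bochner_integral_integral_eq[OF FTC] by (intro ennreal_leI) simp
  also have "\<dots> \<le> (\<integral>\<^sup>+t. ennreal (?f t * indicator {0..T} t) \<partial>lborel)"
    by (intro ennreal_integral_le_nn_integral integrable.intros[OF FTC])
  also have "\<dots> \<le> mean_revenue r (Suc n) s T"
    unfolding mean_revenue_Suc[OF s]
  proof (intro nn_integral_mono)
    fix t :: real
    show "ennreal (?f t * indicator {0..T} t) \<le> ennreal (exponential_density (exit_rate S q s) t) *
       (\<Sum>s'\<in>S. ennreal (?P s') * (if t \<le> T then ennreal (r s s') + mean_revenue r n s' (T - t) else 0))"
    proof (cases "0 \<le> t \<and> t \<le> T")
      case True
      have "ennreal (h s + g / l + ?c t) \<le> ennreal (\<Sum>s'\<in>S. ?P s' * (r s s' + h s' + ?c t))"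
        using mean by (intro ennreal_leI) (simp only: jump_sum_affine[OF s] add_right_mono)
      also have "\<dots> \<le> (\<Sum>s'\<in>S. ennreal (?P s' * (r s s' + h s' + ?c t)))"
        by (rule ennreal_sum_le)
      also have "\<dots> \<le> (\<Sum>s'\<in>S. ennreal (?P s') * (ennreal (r s s') + mean_revenue r n s' (T - t)))"
      proof (intro sum_mono)
        fix s' assume s': "s' \<in> S"
        \<comment> \<open>The lower bound for the remaining revenue may be negative, in which case
          it is replaced by 0 before \<open>ennreal\<close> is distributed over the sum.\<close>
        have "r s s' + h s' + ?c t \<le> r s s' + max 0 (h s' + ?c t)"
          by simp
        then have "ennreal (r s s' + h s' + ?c t) \<le> ennreal (r s s' + max 0 (h s' + ?c t))"
          by (rule ennreal_leI)
        also have "\<dots> = ennreal (r s s') + ennreal (h s' + ?c t)"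
          using r[OF s s'] by (subst ennreal_plus) (auto simp: max_def ennreal_neg)
        also have "ennreal (h s' + ?c t) \<le> mean_revenue r n s' (T - t)"
          using Suc.IH[OF s', of "T - t"] True by (simp add: algebra_simps)
        finally have "ennreal (r s s' + h s' + ?c t) \<le> ennreal (r s s') + mean_revenue r n s' (T - t)"
          by (simp add: add_left_mono)
        then have "ennreal (?P s') * ennreal (r s s' + h s' + ?c t)
            \<le> ennreal (?P s') * (ennreal (r s s') + mean_revenue r n s' (T - t))"
          by (intro mult_left_mono) auto
        then show "ennreal (?P s' * (r s s' + h s' + ?c t))
            \<le> ennreal (?P s') * (ennreal (r s s') + mean_revenue r n s' (T - t))"
          by (subst ennreal_mult'[OF jump_prob_nonneg[OF s s']])
      qed
      finally have "ennreal (l * exp (- l * t)) * ennreal (h s + g / l + ?c t)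
          \<le> ennreal (l * exp (- l * t)) *
          (\<Sum>s'\<in>S. ennreal (?P s') * (ennreal (r s s') + mean_revenue r n s' (T - t)))"
        by (intro mult_left_mono) auto
      moreover have "ennreal (l * exp (- l * t)) * ennreal (h s + g / l + ?c t) = ennreal (?f t)"
        using l by (intro ennreal_mult'[symmetric]) auto
      ultimately show ?thesis
        using True by (simp add: exponential_density_def l_def mult.commute)
    qed auto
  qed
  finally show ?case .
qed

section \<open>Accumulated reward along paths\<close>

text \<open>The condition is imposed at all states, not only at those visited, so that it does not
  mention the initial state and is inherited by the tail of the stream.\<close>

definition regular :: "('a \<Rightarrow> 'a \<times> real) stream \<Rightarrow> bool" where
  "regular \<omega> \<longleftrightarrow> (\<forall>n. \<forall>s\<in>S. fst ((\<omega> !! n) s) \<in> S \<and> 0 < snd ((\<omega> !! n) s))"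

lemma AE_step_pos:
  assumes s: "s \<in> S"
  shows "AE y in step_law S q s. 0 < snd y"
proof (rule AE_I)
  let ?A = "{y \<in> space (step_law S q s). \<not> 0 < snd y}"
  have [measurable]: "snd \<in> borel_measurable (step_law S q s)"
    by (simp add: measurable_cong_sets[OF sets_step_law refl])
  show A: "?A \<in> sets (step_law S q s)"
    by measurable
  show "?A \<subseteq> ?A" ..
  have "emeasure (step_law S q s) ?A = (\<integral>\<^sup>+y. indicator ?A y \<partial>step_law S q s)"
    using A by simp
  also have "\<dots> = (\<integral>\<^sup>+t. ennreal (exponential_density (exit_rate S q s) t) *
       (\<Sum>s'\<in>S. ennreal (q s s' / exit_rate S q s) * indicator ?A (s', t)) \<partial>lborel)"
    using A by (intro nn_integral_step_law s) simp
  also have "\<dots> = (\<integral>\<^sup>+t. 0 \<partial>(lborel :: real measure))"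
  proof (intro nn_integral_cong_AE)
    show "AE t in lborel. ennreal (exponential_density (exit_rate S q s) t) *
       (\<Sum>s'\<in>S. ennreal (q s s' / exit_rate S q s) * indicator ?A (s', t)) = 0"
      \<comment> \<open>The exponential density vanishes for negative times but not at 0, so the
        point 0 is removed as a null set.\<close>
      using AE_lborel_singleton[of "0::real"]
      by eventually_elim (auto simp: exponential_density_def indicator_def)
  qed
  finally show "emeasure (step_law S q s) ?A = 0" by simp
qed

text \<open>Positive holding times hold almost surely at each of finitely many states, hence along
  the whole stream; that the next states lie in \<open>S\<close> holds on the entire sample
  space.\<close>

lemma AE_regular: "AE \<omega> in path_space. regular \<omega>"
proof -
  interpret prob_space step_space by (rule prob_space_step_space)
  have [measurable]: "Measurable.pred step_space (\<lambda>x. \<forall>s\<in>S. 0 < snd (x s))"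
    using finite_states by (intro pred_intros_finite) measurable
  have "AE x in step_space. \<forall>s\<in>S. 0 < snd (x s)"
    using finite_states
    by (intro AE_finite_allI AE_PiM_component[of S "step_law S q" _ "\<lambda>y. 0 < snd y"]
        prob_space_step_law AE_step_pos)
  then have "AE \<omega> in path_space. stream_all (\<lambda>x. \<forall>s\<in>S. 0 < snd (x s)) \<omega>"
    by (intro AE_stream_all) auto
  then show ?thesis
    using AE_space
  proof eventually_elim
    case (elim \<omega>)
    have "fst ((\<omega> !! n) s) \<in> S" if "s \<in> S" for n s
    proof -
      have "\<omega> !! n \<in> space step_space"
        using elim(2) by (simp add: space_stream_space snth_in)
      then have "(\<omega> !! n) s \<in> space (step_law S q s)"
        using that by (auto simp: space_PiM)
      then show ?thesis by (auto simp: space_step_law)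
    qed
    then show ?case
      using elim(1) by (auto simp: regular_def stream_all_def)
  qed
qed

lemma regular_stl: "regular \<omega> \<Longrightarrow> regular (stl \<omega>)"
  unfolding regular_def by (metis snth.simps(2))

lemma regular_shd: "regular \<omega> \<Longrightarrow> s \<in> S \<Longrightarrow> fst (shd \<omega> s) \<in> S \<and> 0 < snd (shd \<omega> s)"
  unfolding regular_def by (metis snth.simps(1))

lemma jump_chain_in: "regular \<omega> \<Longrightarrow> s \<in> S \<Longrightarrow> jump_chain s \<omega> n \<in> S"
  by (induction n) (auto simp: regular_def)

lemma strict_mono_jump_time:
  assumes "regular \<omega>" "s \<in> S"
  shows "strict_mono (jump_time s \<omega>)"
proof (rule strict_mono_Suc_iff[THEN iffD2], rule allI)
  fix n
  show "jump_time s \<omega> n < jump_time s \<omega> (Suc n)"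
    using assms jump_chain_in[OF assms, of n] by (simp add: jump_time_def regular_def)
qed

lemma jump_time_nonneg: "regular \<omega> \<Longrightarrow> s \<in> S \<Longrightarrow> 0 \<le> jump_time s \<omega> n"
  using strict_mono_less_eq[OF strict_mono_jump_time, of \<omega> s 0 n] by (simp add: jump_time_def)

text \<open>The strict inequality in \<open>ctmc\<close> makes paths right-continuous, so at a jump
  time the new state has already been taken.\<close>

lemma ctmc_jump_time:
  assumes "regular \<omega>" "s \<in> S"
  shows "ctmc s \<omega> (jump_time s \<omega> n) = jump_chain s \<omega> n"
proof -
  have "(LEAST m. jump_time s \<omega> n < jump_time s \<omega> (Suc m)) = n"
    using strict_mono_less[OF strict_mono_jump_time[OF assms]] by (intro Least_equality) auto
  then show ?thesis by (simp add: ctmc_def)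
qed

text \<open>Each shift subtracts the first holding time from the horizon and from all later jump
  times alike, so the recursion compares jump times of the original path with the original
  \<open>T\<close>.\<close>

lemma revenue_eq_sum:
  "regular \<omega> \<Longrightarrow> s \<in> S \<Longrightarrow> revenue r n s T \<omega> =
    (\<Sum>k<n. if jump_time s \<omega> (Suc k) \<le> T
            then ennreal (r (jump_chain s \<omega> k) (jump_chain s \<omega> (Suc k))) else 0)"
proof (induction n arbitrary: s T \<omega>)
  case (Suc n)
  let ?s = "fst (shd \<omega> s)" and ?t = "snd (shd \<omega> s)"
  note st = regular_shd[OF Suc.prems] and reg = regular_stl[OF Suc.prems(1)]
  show ?case
  proof (cases "?t \<le> T")
    case True
    have "revenue r n ?s (T - ?t) (stl \<omega>) =
      (\<Sum>k<n. if jump_time s \<omega> (Suc (Suc k)) \<le> T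
            then ennreal (r (jump_chain s \<omega> (Suc k)) (jump_chain s \<omega> (Suc (Suc k)))) else 0)"
      using st by (subst Suc.IH[OF reg])
        (auto simp: jump_time_Suc_shift[of s \<omega>] jump_chain_Suc_shift[of s \<omega>] le_diff_eq add.commute
          simp del: jump_chain.simps(2) cong: if_cong)
    then show ?thesis
      using True unfolding sum.lessThan_Suc_shift by (simp add: jump_time_def)
  next
    case False
    have "\<not> jump_time s \<omega> (Suc k) \<le> T" for k
      using False jump_time_nonneg[OF reg, of ?s k] st by (simp add: jump_time_Suc_shift)
    then show ?thesis using False by simp
  qed
qed simp

text \<open>The integrand of \<open>expected_revenue\<close> for a general reward function, written
  through \<open>ctmc\<close> so that the two agree by unfolding.\<close>

definition path_reward :: "('a \<Rightarrow> 'a \<Rightarrow> real) \<Rightarrow> 'a \<Rightarrow> real \<Rightarrow> ('a \<Rightarrow> 'a \<times> real) stream \<Rightarrow> real" where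
  "path_reward r s T \<omega> = (\<Sum>n | 1 \<le> n \<and> jump_time s \<omega> n \<le> T.
     r (ctmc s \<omega> (jump_time s \<omega> (n - 1))) (ctmc s \<omega> (jump_time s \<omega> n)))"

lemma measurable_jump_chain:
  assumes s: "s \<in> S" shows "(\<lambda>\<omega>. jump_chain s \<omega> n) \<in> path_space \<rightarrow>\<^sub>M count_space S"
proof (induction n)
  case 0
  then show ?case using s by simp
next
  case (Suc n)
  have "(\<lambda>\<omega>. fst ((\<omega> !! n) s')) \<in> path_space \<rightarrow>\<^sub>M count_space S" if "s' \<in> S" for s'
    by (rule measurable_compose[OF measurable_snth measurable_fst_step[OF that]])
  from measurable_compose_countable'[where f = "\<lambda>s' \<omega>. fst ((\<omega> !! n) s')", OF this Suc countable_finite[OF finite_states]]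
  show ?case unfolding jump_chain.simps .
qed

lemma measurable_jump_time:
  assumes s: "s \<in> S" shows "(\<lambda>\<omega>. jump_time s \<omega> n) \<in> borel_measurable path_space"
proof -
  have "(\<lambda>\<omega>. snd ((\<omega> !! k) (jump_chain s \<omega> k))) \<in> borel_measurable path_space" for k
  proof -
    have "(\<lambda>\<omega>. snd ((\<omega> !! k) s')) \<in> borel_measurable path_space" if "s' \<in> S" for s'
      by (rule measurable_compose[OF measurable_snth measurable_snd_step[OF that]])
    from measurable_compose_countable'[where f = "\<lambda>s' \<omega>. snd ((\<omega> !! k) s')",
        OF this measurable_jump_chain[OF s] countable_finite[OF finite_states]]
    show ?thesis .
  qed
  then show ?thesis
    unfolding jump_time_def by measurable
qed

lemma measurable_ctmc_jump_time:
  assumes s: "s \<in> S" shows "(\<lambda>\<omega>. ctmc s \<omega> (jump_time s \<omega> n)) \<in> path_space \<rightarrow>\<^sub>M count_space S"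
proof -
  note [measurable] = measurable_jump_time[OF s]
  have "(\<lambda>\<omega>. LEAST m. jump_time s \<omega> n < jump_time s \<omega> (Suc m)) \<in> path_space \<rightarrow>\<^sub>M count_space UNIV"
    by measurable
  from measurable_compose_countable'[OF measurable_jump_chain[OF s] this]
  show ?thesis by (simp add: ctmc_def)
qed

lemma measurable_path_reward [measurable]:
  assumes s [measurable]: "s \<in> S" shows "path_reward r s T \<in> borel_measurable path_space"
proof -
  note [measurable] = measurable_jump_time[OF s]
  let ?P = "\<lambda>\<omega> n. 1 \<le> n \<and> jump_time s \<omega> n \<le> T"
  let ?X = "\<lambda>\<omega> n. ctmc s \<omega> (jump_time s \<omega> n)"
  let ?c = "\<lambda>\<omega> n. r (?X \<omega> (n - 1)) (?X \<omega> n)"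
  have m [measurable]: "(\<lambda>\<omega>. ?c \<omega> n) \<in> borel_measurable path_space" for n
  proof -
    have "(\<lambda>\<omega>. r s' (?X \<omega> n)) \<in> borel_measurable path_space" for s'
      by (rule measurable_compose[OF measurable_ctmc_jump_time[OF s]]) simp
    from measurable_compose_countable'[OF this measurable_ctmc_jump_time[OF s] countable_finite[OF finite_states]]
    show ?thesis .
  qed
  \<comment> \<open>A sum over an infinite set is 0 by convention. The case distinction reproduces
    this value with countable operations, which are measurable.\<close>
  have eq: "path_reward r s T = (\<lambda>\<omega>. if \<exists>m. \<forall>n\<ge>m. \<not> ?P \<omega> n then (\<Sum>n. if ?P \<omega> n then ?c \<omega> n else 0) else 0)"
  proof
    fix \<omega>
    show "path_reward r s T \<omega> = (if \<exists>m. \<forall>n\<ge>m. \<not> ?P \<omega> n then (\<Sum>n. if ?P \<omega> n then ?c \<omega> n else 0) else 0)"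
    proof (cases "finite {n. ?P \<omega> n}")
      case True
      then have "\<exists>m. \<forall>n\<ge>m. \<not> ?P \<omega> n"
        unfolding finite_nat_set_iff_bounded by (metis mem_Collect_eq not_less)
      moreover have "(\<Sum>n. if ?P \<omega> n then ?c \<omega> n else 0) = (\<Sum>n | ?P \<omega> n. if ?P \<omega> n then ?c \<omega> n else 0)"
        using True by (intro suminf_finite) auto
      ultimately show ?thesis by (simp add: path_reward_def)
    next
      case False
      then have "\<not> (\<exists>m. \<forall>n\<ge>m. \<not> ?P \<omega> n)"
        unfolding finite_nat_set_iff_bounded by (metis mem_Collect_eq not_less)
      then show ?thesis
        unfolding path_reward_def sum.infinite[OF False] by (subst if_not_P) auto
    qed
  qed
  show ?thesis
    unfolding eq by measurable
qed

lemma mean_revenue_SUP: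
  assumes "s \<in> S"
  shows "(\<integral>\<^sup>+\<omega>. (SUP n. revenue r n s T \<omega>) \<partial>path_space) = (SUP n. mean_revenue r n s T)"
  unfolding mean_revenue_def
  using assms by (intro nn_integral_monotone_convergence_SUP)
    (auto simp: incseq_def le_fun_def intro: incseqD[OF incseq_revenue])

text \<open>The expected number of jumps in bounded time is finite: it is the revenue for a unit reward per jump.\<close>

lemma AE_finite_jumps:
  assumes s: "s \<in> S" and T: "0 \<le> T"
  shows "AE \<omega> in path_space. finite {k. jump_time s \<omega> (Suc k) \<le> T}"
proof -
  let ?one = "\<lambda>_ _. 1 :: real"
  let ?g = "\<Sum>s\<in>S. exit_rate S q s"
  have g: "exit_rate S q s \<le> ?g" if "s \<in> S" for s
    using that finite_states exit_rate_pos by (intro member_le_sum) (auto intro: less_imp_le)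
  have "0 \<le> ?g" using exit_rate_pos by (intro sum_nonneg) (auto intro: less_imp_le)
  \<comment> \<open>With \<open>h = 0\<close> the generator sum for a unit reward is the exit rate,
    which is at most \<open>?g\<close>.\<close>
  then have "mean_revenue ?one n s T \<le> ennreal (?g * T + 0)" for n
    using g by (intro mean_revenue_le s T) (auto simp: exit_rate_def)
  then have "(SUP n. mean_revenue ?one n s T) \<le> ennreal (?g * T + 0)"
    by (intro SUP_least)
  then have "(\<integral>\<^sup>+\<omega>. (SUP n. revenue ?one n s T \<omega>) \<partial>path_space) \<noteq> \<infinity>"
    unfolding mean_revenue_SUP[OF s] by (metis ennreal_less_top infinity_ennreal_def not_le)
  then have "AE \<omega> in path_space. (SUP n. revenue ?one n s T \<omega>) \<noteq> \<infinity>"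
    using s by (intro nn_integral_noteq_infinite) auto
  then show ?thesis
    using AE_regular
  proof eventually_elim
    case (elim \<omega>)
    note mono = strict_mono_less_eq[OF strict_mono_jump_time[OF elim(2) s]]
    show ?case
    proof (rule ccontr)
      assume inf: "infinite {k. jump_time s \<omega> (Suc k) \<le> T}"
      have "jump_time s \<omega> (Suc k) \<le> T" for k
      proof -
        from inf obtain m where "k \<le> m" "jump_time s \<omega> (Suc m) \<le> T"
          unfolding infinite_nat_iff_unbounded_le by auto
        then show ?thesis using mono[of "Suc k" "Suc m"] by linarith
      qed
      then have rev: "revenue ?one n s T \<omega> = of_nat n" for n
        by (simp add: revenue_eq_sum[OF elim(2) s])
      have "(SUP n. revenue ?one n s T \<omega>) = \<infinity>"
        unfolding rev by (rule ennreal_SUP_of_nat_eq_top[unfolded infinity_ennreal_def[symmetric]])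
      with elim(1) show False by simp
    qed
  qed
qed

text \<open>Almost surely only finitely many jumps occur by time \<open>T\<close>, so the increasing
  truncated sums reach the full finite sum at some \<open>n\<close>.\<close>

lemma AE_path_reward:
  assumes s: "s \<in> S" and T: "0 \<le> T"
    and r: "\<And>s s'. s \<in> S \<Longrightarrow> s' \<in> S \<Longrightarrow> 0 \<le> r s s'"
  shows "AE \<omega> in path_space. (SUP n. revenue r n s T \<omega>) = ennreal (path_reward r s T \<omega>) \<and> 0 \<le> path_reward r s T \<omega>"
  using AE_finite_jumps[OF s T] AE_regular
proof eventually_elim
  case (elim \<omega>)
  let ?A = "{k. jump_time s \<omega> (Suc k) \<le> T}"
  let ?r = "\<lambda>k. r (jump_chain s \<omega> k) (jump_chain s \<omega> (Suc k))"
  have r': "0 \<le> ?r k" for k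
    using jump_chain_in[OF elim(2) s, of k] jump_chain_in[OF elim(2) s, of "Suc k"] by (rule r)
  have "{n. 1 \<le> n \<and> jump_time s \<omega> n \<le> T} = Suc ` ?A"
    by (auto simp: image_iff) (metis Suc_le_D One_nat_def)
  then have path: "path_reward r s T \<omega> = (\<Sum>k\<in>?A. ?r k)"
    unfolding path_reward_def ctmc_jump_time[OF elim(2) s] by (simp add: sum.reindex del: jump_chain.simps)
  have rev: "revenue r n s T \<omega> = ennreal (\<Sum>k\<in>?A \<inter> {..<n}. ?r k)" for n
  proof -
    have "revenue r n s T \<omega> = (\<Sum>k\<in>?A \<inter> {..<n}. ennreal (?r k))"
      unfolding revenue_eq_sum[OF elim(2) s] by (subst sum.inter_filter[symmetric]) (auto intro!: sum.cong)
    then show ?thesis using r' by (simp add: sum_ennreal del: jump_chain.simps)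
  qed
  have "(SUP n. revenue r n s T \<omega>) = ennreal (\<Sum>k\<in>?A. ?r k)"
  proof (rule antisym)
    show "(SUP n. revenue r n s T \<omega>) \<le> ennreal (\<Sum>k\<in>?A. ?r k)"
      unfolding rev using elim(1) r' by (intro SUP_least ennreal_leI sum_mono2) auto
    obtain n where "?A \<subseteq> {..<n}"
      using elim(1) finite_nat_iff_bounded by blast
    then have "?A \<inter> {..<n} = ?A" by blast
    then have "ennreal (\<Sum>k\<in>?A. ?r k) = revenue r n s T \<omega>"
      unfolding rev by simp
    also have "\<dots> \<le> (SUP n. revenue r n s T \<omega>)" by (rule SUP_upper) simp
    finally show "ennreal (\<Sum>k\<in>?A. ?r k) \<le> (SUP n. revenue r n s T \<omega>)" .
  qed
  then show ?case
    using r' by (simp add: path sum_nonneg del: jump_chain.simps)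
qed

text \<open>Monotone convergence in the number of jumps. Both sides are 0 if the supremum is
  infinite, so lower bounds for the integral require finiteness first.\<close>

lemma integral_path_reward:
  assumes s: "s \<in> S" and T: "0 \<le> T"
    and r: "\<And>s s'. s \<in> S \<Longrightarrow> s' \<in> S \<Longrightarrow> 0 \<le> r s s'"
  shows "(\<integral>\<omega>. path_reward r s T \<omega> \<partial>path_space) = enn2real (SUP n. mean_revenue r n s T)"
proof -
  have "(\<integral>\<omega>. path_reward r s T \<omega> \<partial>path_space) = enn2real (\<integral>\<^sup>+\<omega>. ennreal (path_reward r s T \<omega>) \<partial>path_space)"
    using AE_path_reward[where r = r, OF assms] s by (intro integral_eq_nn_integral) auto
  also have "(\<integral>\<^sup>+\<omega>. ennreal (path_reward r s T \<omega>) \<partial>path_space) = (\<integral>\<^sup>+\<omega>. (SUP n. revenue r n s T \<omega>) \<partial>path_space)"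
    using AE_path_reward[where r = r, OF assms] by (intro nn_integral_cong_AE) auto
  finally show ?thesis by (simp add: mean_revenue_SUP[OF s])
qed

section \<open>Long-run average reward and the Poisson equation\<close>

text \<open>The generator annihilates constants, so \<open>h\<close> can be shifted up by
  \<open>?M\<close> to become nonnegative. The bound on \<open>mean_revenue\<close> is stated along
  with the integral because the lower estimate takes finiteness from it.\<close>

lemma path_reward_rate_le:
  assumes r: "\<And>s s'. s \<in> S \<Longrightarrow> s' \<in> S \<Longrightarrow> 0 \<le> r s s'"
    and g: "0 \<le> g"
    and super: "\<And>s. s \<in> S \<Longrightarrow> (\<Sum>s'\<in>S. q s s' * (r s s' + h s' - h s)) \<le> g"
  shows "\<exists>C. \<forall>s\<in>S. \<forall>T\<ge>0. (\<forall>n. mean_revenue r n s T \<le> ennreal (g * T + C)) \<and>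
    (\<integral>\<omega>. path_reward r s T \<omega> \<partial>path_space) \<le> g * T + C"
proof -
  let ?M = "\<Sum>s\<in>S. \<bar>h s\<bar>"
  have M: "\<bar>h s\<bar> \<le> ?M" if "s \<in> S" for s
    using that finite_states by (intro member_le_sum) auto
  have V: "mean_revenue r n s T \<le> ennreal (g * T + 2 * ?M)" if "s \<in> S" "0 \<le> T" for s T n
  proof -
    have "mean_revenue r n s T \<le> ennreal (g * T + (h s + ?M))"
    proof (intro mean_revenue_le r g that)
      fix s assume s: "s \<in> S"
      show "0 \<le> h s + ?M" using M[OF s] by (simp add: abs_le_iff)
      have "r s s' + (h s' + ?M) - (h s + ?M) = r s s' + h s' - h s" for s' by simp
      then show "(\<Sum>s'\<in>S. q s s' * (r s s' + (h s' + ?M) - (h s + ?M))) \<le> g"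
        using super[OF s] by (simp only:)
    qed
    also have "\<dots> \<le> ennreal (g * T + 2 * ?M)"
      using M[OF that(1)] by (intro ennreal_leI) auto
    finally show ?thesis .
  qed
  have "(\<integral>\<omega>. path_reward r s T \<omega> \<partial>path_space) \<le> g * T + 2 * ?M" if "s \<in> S" "0 \<le> T" for s T
  proof -
    have "(SUP n. mean_revenue r n s T) \<le> ennreal (g * T + 2 * ?M)"
      by (intro SUP_least V that)
    moreover have "0 \<le> g * T + 2 * ?M"
      using g that by (intro add_nonneg_nonneg) (auto intro: sum_nonneg)
    ultimately show ?thesis
      using integral_path_reward[OF that, where r = r, OF r] by (simp add: enn2real_leI)
  qed
  with V show ?thesis by blast
qed

text \<open>Here \<open>h\<close> is shifted down by \<open>?M\<close> to become nonpositive. A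
  common \<rho> below 1 exists since there are finitely many exit rates, and the error
  \<open>g * \<rho> ^ n * exp T\<close> vanishes as \<open>n\<close> tends to infinity with
  \<open>T\<close> fixed.\<close>

lemma path_reward_rate_ge:
  assumes r: "\<And>s s'. s \<in> S \<Longrightarrow> s' \<in> S \<Longrightarrow> 0 \<le> r s s'"
    and g: "0 \<le> g"
    and sub: "\<And>s. s \<in> S \<Longrightarrow> g \<le> (\<Sum>s'\<in>S. q s s' * (r s s' + h s' - h s))"
  shows "\<exists>C. \<forall>s\<in>S. \<forall>T\<ge>0. g * T - C \<le> (\<integral>\<omega>. path_reward r s T \<omega> \<partial>path_space)"
proof -
  let ?M = "\<Sum>s\<in>S. \<bar>h s\<bar>"
  have M: "\<bar>h s\<bar> \<le> ?M" if "s \<in> S" for s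
    using that finite_states by (intro member_le_sum) auto
  define L where "L = (\<Sum>s\<in>S. exit_rate S q s)"
  have L: "exit_rate S q s \<le> L" if "s \<in> S" for s
    unfolding L_def using that finite_states exit_rate_pos by (intro member_le_sum) (auto intro: less_imp_le)
  have L0: "0 \<le> L"
    unfolding L_def using exit_rate_pos by (intro sum_nonneg) (auto intro: less_imp_le)
  define \<rho> where "\<rho> = L / (L + 1)"
  have \<rho>: "0 \<le> \<rho>" "\<rho> < 1" using L0 by (auto simp: \<rho>_def)
  have rho: "exit_rate S q s / (exit_rate S q s + 1) \<le> \<rho>" if "s \<in> S" for s
    using L[OF that] L0 exit_rate_pos[OF that] by (simp add: \<rho>_def field_simps)
  \<comment> \<open>A crude bound for the reward rate in every state; with \<open>h = 0\<close> it
    gives finiteness of the mean revenue.\<close>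
  define g0 where "g0 = (\<Sum>s\<in>S. \<Sum>s'\<in>S. q s s' * r s s')"
  have qr: "0 \<le> q s s' * r s s'" if "s \<in> S" "s' \<in> S" for s s'
    using that r rate_nonneg by simp
  have g0: "0 \<le> g0" "\<And>s. s \<in> S \<Longrightarrow> (\<Sum>s'\<in>S. q s s' * (r s s' + 0 - 0)) \<le> g0"
    unfolding g0_def using finite_states
    by (auto intro!: sum_nonneg qr member_le_sum[where f = "\<lambda>s. \<Sum>s'\<in>S. q s s' * r s s'"])
  obtain C where C: "\<And>s T n. s \<in> S \<Longrightarrow> 0 \<le> T \<Longrightarrow> mean_revenue r n s T \<le> ennreal (g0 * T + C)"
    using path_reward_rate_le[where r = r and h = "\<lambda>_. 0", OF r g0] by blast
  have "g * T - 2 * ?M \<le> (\<integral>\<omega>. path_reward r s T \<omega> \<partial>path_space)" if s: "s \<in> S" and T: "0 \<le> T" for s T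
  proof -
    let ?I = "\<integral>\<omega>. path_reward r s T \<omega> \<partial>path_space"
    have fin: "(SUP n. mean_revenue r n s T) < top"
      by (rule le_less_trans[OF SUP_least[OF C[OF s T]] ennreal_less_top])
    have "g * T + (h s - ?M) - g * \<rho> ^ n * exp T \<le> ?I" for n
    proof -
      have "ennreal (g * T + (h s - ?M) - g * \<rho> ^ n * exp T) \<le> mean_revenue r n s T"
      proof (intro mean_revenue_ge r g rho s T)
        fix s assume s: "s \<in> S"
        show "h s - ?M \<le> 0" using M[OF s] by (simp add: abs_le_iff)
        have "r s s' + (h s' - ?M) - (h s - ?M) = r s s' + h s' - h s" for s' by simp
        then show "g \<le> (\<Sum>s'\<in>S. q s s' * (r s s' + (h s' - ?M) - (h s - ?M)))"
          using sub[OF s] by (simp only:)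
      qed
      also have "\<dots> \<le> (SUP n. mean_revenue r n s T)"
        by (rule SUP_upper) simp
      also have "\<dots> = ennreal ?I"
        using integral_path_reward[OF that, where r = r, OF r] fin by simp
      finally show ?thesis
        using integral_path_reward[OF that, where r = r, OF r] by (simp add: ennreal_le_iff)
    qed
    moreover have "(\<lambda>n. g * T + (h s - ?M) - g * \<rho> ^ n * exp T) \<longlonglongrightarrow> g * T + (h s - ?M) - g * 0 * exp T"
      by (intro tendsto_intros LIMSEQ_realpow_zero \<rho>)
    ultimately have "g * T + (h s - ?M) - g * 0 * exp T \<le> ?I"
      by (intro LIMSEQ_le_const2) auto
    then show ?thesis
      using M[OF s] by (simp add: abs_le_iff)
  qed
  then show ?thesis by blast
qed

definition average_reward :: "('a \<Rightarrow> 'a \<Rightarrow> real) \<Rightarrow> real" where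
  "average_reward r = (THE g. \<forall>s\<in>S.
     ((\<lambda>T. 1 / T * (\<integral>\<omega>. path_reward r s T \<omega> \<partial>path_space)) \<longlongrightarrow> g) at_top)"

text \<open>
  Monotone iteration for the chain killed on hitting \<open>s0\<close>; the Lyapunov function keeps it bounded.
\<close>

lemma killed_equation:
  assumes w: "\<And>s. s \<in> S \<Longrightarrow> 0 \<le> w s"
    and drift: "\<And>s. s \<in> S \<Longrightarrow> s \<noteq> s0 \<Longrightarrow> (\<Sum>s'\<in>S. q s s' * (w s' - w s)) \<le> -1"
    and s0: "s0 \<in> S" and f: "\<And>s. s \<in> S \<Longrightarrow> 0 \<le> f s"
  shows "\<exists>u. \<forall>s\<in>S. 0 \<le> u s \<and> exit_rate S q s * u s = f s + (\<Sum>s'\<in>S - {s0}. q s s' * u s')"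
proof -
  \<comment> \<open>The drift condition says nothing at \<open>s0\<close>. The value there is
    replaced so that the killed inequality \<open>w'\<close> holds with equality at
    \<open>s0\<close>; the sums over \<open>S - {s0}\<close> do not see the change.\<close>
  define w' where "w' s = (if s = s0 then (1 + (\<Sum>s'\<in>S - {s0}. q s0 s' * w s')) / exit_rate S q s0 else w s)" for s
  have sum0: "(\<Sum>s'\<in>S - {s0}. q s s' * w' s') = (\<Sum>s'\<in>S - {s0}. q s s' * w s')" for s
    by (intro sum.cong) (auto simp: w'_def)
  have w': "1 + (\<Sum>s'\<in>S - {s0}. q s s' * w' s') \<le> exit_rate S q s * w' s" if s: "s \<in> S" for s
  proof (cases "s = s0")
    case True
    then show ?thesis using exit_rate_pos[OF s0] by (simp only: sum0) (simp add: w'_def)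
  next
    case False
    have "(\<Sum>s'\<in>S - {s0}. q s s' * w s') \<le> (\<Sum>s'\<in>S. q s s' * w s')"
      using finite_states rate_nonneg[OF s] w s0 by (intro sum_mono2) auto
    also have "\<dots> = (\<Sum>s'\<in>S. q s s' * (w s' - w s)) + exit_rate S q s * w s"
      by (simp add: right_diff_distrib sum_subtractf sum_distrib_right exit_rate_def)
    finally show ?thesis
      using drift[OF s False] False by (simp only: sum0) (simp add: w'_def)
  qed
  \<comment> \<open>Iteration of the equation, divided by the exit rate, starting from 0.\<close>
  define U where "U = rec_nat (\<lambda>_. 0) (\<lambda>_ u s. (f s + (\<Sum>s'\<in>S - {s0}. q s s' * u s')) / exit_rate S q s)"
  have U0: "U 0 s = 0" and USuc: "U (Suc n) s = (f s + (\<Sum>s'\<in>S - {s0}. q s s' * U n s')) / exit_rate S q s" for n s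
    by (simp_all add: U_def)
  have mono: "U n s \<le> U (Suc n) s" if "s \<in> S" for n s
    using that
  proof (induction n arbitrary: s)
    case 0
    then show ?case using f exit_rate_pos[OF 0] by (simp add: USuc U0)
  next
    case (Suc n)
    show ?case
      unfolding USuc[of "Suc n" s] USuc[of n s]
      using rate_nonneg[OF Suc.prems] Suc.IH exit_rate_pos[OF Suc.prems]
      by (intro divide_right_mono add_left_mono sum_mono mult_left_mono) (auto intro: less_imp_le)
  qed
  define F where "F = (\<Sum>s\<in>S. f s)"
  have F: "f s \<le> F" if "s \<in> S" for s
    unfolding F_def using that finite_states f by (intro member_le_sum) auto
  have F0: "0 \<le> F" unfolding F_def by (intro sum_nonneg f)
  have w'0: "0 \<le> w' s" if "s \<in> S" for s
    unfolding w'_def using w s0 exit_rate_pos[OF s0] rate_nonneg[OF s0] that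
    by (auto intro!: divide_nonneg_pos add_nonneg_nonneg sum_nonneg)
  \<comment> \<open>\<open>F * w'\<close> satisfies the equation with \<open>\<ge>\<close>, so the
    iteration never rises above it.\<close>
  have bound: "U n s \<le> F * w' s" if "s \<in> S" for n s
    using that
  proof (induction n arbitrary: s)
    case 0
    then show ?case using F0 w'0 by (simp add: U0)
  next
    case (Suc n)
    have "f s + (\<Sum>s'\<in>S - {s0}. q s s' * U n s') \<le> F + (\<Sum>s'\<in>S - {s0}. q s s' * (F * w' s'))"
      using rate_nonneg[OF Suc.prems] Suc.IH F[OF Suc.prems] by (intro add_mono sum_mono mult_left_mono) auto
    also have "\<dots> = F * (1 + (\<Sum>s'\<in>S - {s0}. q s s' * w' s'))"
      by (simp add: sum_distrib_left algebra_simps)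
    also have "\<dots> \<le> F * (exit_rate S q s * w' s)"
      by (intro mult_left_mono w' F0 Suc.prems)
    finally show ?case
      unfolding USuc using exit_rate_pos[OF Suc.prems] by (simp add: divide_simps mult_ac)
  qed
  have conv: "\<exists>u. (\<lambda>n. U n s) \<longlonglongrightarrow> u" if "s \<in> S" for s
  proof -
    have "incseq (\<lambda>n. U n s)" using mono[OF that] by (rule incseq_SucI)
    then show ?thesis
      using incseq_convergent[of "\<lambda>n. U n s" "F * w' s"] bound[OF that] by metis
  qed
  then obtain u where u: "\<And>s. s \<in> S \<Longrightarrow> (\<lambda>n. U n s) \<longlonglongrightarrow> u s" by metis
  have U_nonneg: "0 \<le> U n s" if "s \<in> S" for n s
    using that
  proof (induction n)
    case (Suc n)
    with mono[of s n] show ?case by simp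
  qed (simp add: U0)
  show ?thesis
  proof (intro exI[of _ u] ballI conjI)
    fix s assume s: "s \<in> S"
    show "0 \<le> u s" using U_nonneg[OF s] by (intro LIMSEQ_le_const[OF u[OF s]]) auto
    have "(\<lambda>n. U (Suc n) s) \<longlonglongrightarrow> (f s + (\<Sum>s'\<in>S - {s0}. q s s' * u s')) / exit_rate S q s"
      unfolding USuc using exit_rate_pos[OF s] by (intro tendsto_intros u) auto
    moreover have "(\<lambda>n. U (Suc n) s) \<longlonglongrightarrow> u s"
      using u[OF s] by (rule LIMSEQ_Suc)
    ultimately have "u s = (f s + (\<Sum>s'\<in>S - {s0}. q s s' * u s')) / exit_rate S q s"
      by (rule LIMSEQ_unique[symmetric])
    then show "exit_rate S q s * u s = f s + (\<Sum>s'\<in>S - {s0}. q s s' * u s')"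
      using exit_rate_pos[OF s] by simp
  qed
qed

text \<open>A regenerative construction: \<open>u\<close> and \<open>v\<close> solve the equations
  for the expected reward and the expected time up to the next visit to \<open>s0\<close>. The ratio
  \<open>g = u s0 / v s0\<close> is reward per cycle over cycle length, and it makes
  \<open>h = u - g * v\<close> vanish at \<open>s0\<close>, so that the killed sums for
  \<open>h\<close> become full sums.\<close>

lemma poisson_equation:
  assumes w: "\<And>s. s \<in> S \<Longrightarrow> 0 \<le> w s"
    and drift: "\<And>s. s \<in> S \<Longrightarrow> s \<noteq> s0 \<Longrightarrow> (\<Sum>s'\<in>S. q s s' * (w s' - w s)) \<le> -1"
    and s0: "s0 \<in> S" and r: "\<And>s s'. s \<in> S \<Longrightarrow> s' \<in> S \<Longrightarrow> 0 \<le> r s s'"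
  shows "\<exists>g h. 0 \<le> g \<and> (\<forall>s\<in>S. (\<Sum>s'\<in>S. q s s' * (r s s' + h s' - h s)) = g)"
proof -
  have f: "0 \<le> (\<Sum>s'\<in>S. q s s' * r s s')" if "s \<in> S" for s
    using that r rate_nonneg by (intro sum_nonneg) auto
  obtain u where u0: "\<And>s. s \<in> S \<Longrightarrow> 0 \<le> u s"
    and u: "\<And>s. s \<in> S \<Longrightarrow> exit_rate S q s * u s = (\<Sum>s'\<in>S. q s s' * r s s') + (\<Sum>s'\<in>S - {s0}. q s s' * u s')"
    using killed_equation[where w = w and f = "\<lambda>s. \<Sum>s'\<in>S. q s s' * r s s'", OF w drift s0 f] by blast
  obtain v where v0: "\<And>s. s \<in> S \<Longrightarrow> 0 \<le> v s"
    and v: "\<And>s. s \<in> S \<Longrightarrow> exit_rate S q s * v s = 1 + (\<Sum>s'\<in>S - {s0}. q s s' * v s')"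
    using killed_equation[where w = w and f = "\<lambda>_. 1", OF w drift s0 zero_le_one] by blast
  have "0 \<le> (\<Sum>s'\<in>S - {s0}. q s0 s' * v s')"
    using rate_nonneg[OF s0] v0 by (intro sum_nonneg) auto
  then have "0 < exit_rate S q s0 * v s0"
    using v[OF s0] by linarith
  then have vpos: "0 < v s0"
    using exit_rate_pos[OF s0] by (simp add: zero_less_mult_iff)
  define g where "g = u s0 / v s0"
  define h where "h s = u s - g * v s" for s
  have h0: "h s0 = 0" using vpos by (simp add: h_def g_def)
  have "(\<Sum>s'\<in>S. q s s' * (r s s' + h s' - h s)) = g" if s: "s \<in> S" for s
  proof -
    have "(\<Sum>s'\<in>S. q s s' * h s') = (\<Sum>s'\<in>S - {s0}. q s s' * h s')"
      using finite_states s0 h0 by (simp add: sum.remove[of S s0])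
    also have "\<dots> = (\<Sum>s'\<in>S - {s0}. q s s' * u s') - g * (\<Sum>s'\<in>S - {s0}. q s s' * v s')"
    proof -
      have "q s s' * h s' = q s s' * u s' - g * (q s s' * v s')" for s'
        unfolding h_def by (simp add: right_diff_distrib)
      then show ?thesis
        by (simp only: sum_subtractf sum_distrib_left)
    qed
    also have "\<dots> = exit_rate S q s * u s - (\<Sum>s'\<in>S. q s s' * r s s') - g * (exit_rate S q s * v s - 1)"
      unfolding u[OF s] v[OF s] by simp
    also have "\<dots> = exit_rate S q s * h s - (\<Sum>s'\<in>S. q s s' * r s s') + g"
      unfolding h_def by (simp add: algebra_simps)
    finally have "(\<Sum>s'\<in>S. q s s' * h s') = exit_rate S q s * h s - (\<Sum>s'\<in>S. q s s' * r s s') + g" .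
    moreover have "(\<Sum>s'\<in>S. q s s' * (r s s' + h s' - h s)) =
      (\<Sum>s'\<in>S. q s s' * r s s') + (\<Sum>s'\<in>S. q s s' * h s') - exit_rate S q s * h s"
      by (simp add: right_diff_distrib distrib_left sum.distrib sum_subtractf sum_distrib_right exit_rate_def)
    ultimately show ?thesis by simp
  qed
  moreover have "0 \<le> g" using u0[OF s0] vpos by (simp add: g_def)
  ultimately show ?thesis by blast
qed

text \<open>A solution of Poisson's equation is both an upper and a lower solution, so the expected
  reward up to \<open>T\<close> differs from \<open>g1 * T\<close> by a bounded amount and the limit
  is \<open>g1\<close> from every initial state. Any other upper or lower solution is then compared
  with this limit at \<open>s0\<close>.\<close>

lemma
  assumes w: "\<And>s. s \<in> S \<Longrightarrow> 0 \<le> w s"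
    and drift: "\<And>s. s \<in> S \<Longrightarrow> s \<noteq> s0 \<Longrightarrow> (\<Sum>s'\<in>S. q s s' * (w s' - w s)) \<le> -1"
    and s0: "s0 \<in> S" and r: "\<And>s s'. s \<in> S \<Longrightarrow> s' \<in> S \<Longrightarrow> 0 \<le> r s s'" and g: "0 \<le> g"
  shows average_reward_le:
      "(\<And>s. s \<in> S \<Longrightarrow> (\<Sum>s'\<in>S. q s s' * (r s s' + h s' - h s)) \<le> g) \<Longrightarrow> average_reward r \<le> g"
    and average_reward_ge:
      "(\<And>s. s \<in> S \<Longrightarrow> g \<le> (\<Sum>s'\<in>S. q s s' * (r s s' + h s' - h s))) \<Longrightarrow> g \<le> average_reward r"
proof -
  let ?R = "\<lambda>s T. \<integral>\<omega>. path_reward r s T \<omega> \<partial>path_space"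
  have limC: "((\<lambda>T. x + C / T) \<longlongrightarrow> x) at_top" for x C :: real
    using tendsto_add[OF tendsto_const tendsto_divide_0[OF tendsto_const filterlim_at_top_imp_at_infinity[OF filterlim_ident]], of x C]
    by simp
  have scale_le: "\<forall>\<^sub>F T in at_top. 1 / T * ?R s T \<le> x + C / T"
    if "\<And>T. 0 \<le> T \<Longrightarrow> ?R s T \<le> x * T + C" for s x C
    using eventually_gt_at_top[of 0]
  proof eventually_elim
    case (elim T)
    have "?R s T / T \<le> (x * T + C) / T"
      using that[of T] elim by (intro divide_right_mono) auto
    with elim show ?case by (simp add: add_divide_distrib)
  qed
  have scale_ge: "\<forall>\<^sub>F T in at_top. x + - C / T \<le> 1 / T * ?R s T"
    if "\<And>T. 0 \<le> T \<Longrightarrow> x * T - C \<le> ?R s T" for s x C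
    using eventually_gt_at_top[of 0]
  proof eventually_elim
    case (elim T)
    have "(x * T - C) / T \<le> ?R s T / T"
      using that[of T] elim by (intro divide_right_mono) auto
    with elim show ?case by (simp add: diff_divide_distrib)
  qed
  obtain g1 h1 where g1: "0 \<le> g1" and h1: "\<And>s. s \<in> S \<Longrightarrow> (\<Sum>s'\<in>S. q s s' * (r s s' + h1 s' - h1 s)) = g1"
    using poisson_equation[where w = w and r = r, OF w drift s0 r] by blast
  have h1_le: "(\<Sum>s'\<in>S. q s s' * (r s s' + h1 s' - h1 s)) \<le> g1"
    and h1_ge: "g1 \<le> (\<Sum>s'\<in>S. q s s' * (r s s' + h1 s' - h1 s))" if "s \<in> S" for s
    using h1[OF that] by simp_all
  have lim: "((\<lambda>T. 1 / T * ?R s T) \<longlongrightarrow> g1) at_top" if "s \<in> S" for s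
  proof -
    have "\<exists>C. \<forall>s\<in>S. \<forall>T\<ge>0. (\<forall>n. mean_revenue r n s T \<le> ennreal (g1 * T + C)) \<and> ?R s T \<le> g1 * T + C"
      by (rule path_reward_rate_le[where h = h1]) (fact r g1 h1_le)+
    then obtain C where "\<forall>s\<in>S. \<forall>T\<ge>0. (\<forall>n. mean_revenue r n s T \<le> ennreal (g1 * T + C)) \<and> ?R s T \<le> g1 * T + C" ..
    then have C: "?R s T \<le> g1 * T + C" if "0 \<le> T" for T
      using that \<open>s \<in> S\<close> by simp
    have "\<exists>C. \<forall>s\<in>S. \<forall>T\<ge>0. g1 * T - C \<le> ?R s T"
      by (rule path_reward_rate_ge[where h = h1]) (fact r g1 h1_ge)+
    then obtain C' where "\<forall>s\<in>S. \<forall>T\<ge>0. g1 * T - C' \<le> ?R s T" ..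
    then have C': "g1 * T - C' \<le> ?R s T" if "0 \<le> T" for T
      using that \<open>s \<in> S\<close> by simp
    show ?thesis
      by (rule tendsto_sandwich[OF scale_ge[OF C'] scale_le[OF C] limC limC])
  qed
  have avg: "average_reward r = g1"
    unfolding average_reward_def
  proof (rule the_equality)
    fix x assume "\<forall>s\<in>S. ((\<lambda>T. 1 / T * ?R s T) \<longlongrightarrow> x) at_top"
    then show "x = g1"
      using lim[OF s0] s0 by (metis tendsto_unique trivial_limit_at_top_linorder)
  qed (use lim in auto)
  {
    assume h: "\<And>s. s \<in> S \<Longrightarrow> (\<Sum>s'\<in>S. q s s' * (r s s' + h s' - h s)) \<le> g"
    obtain C where C: "\<And>T. 0 \<le> T \<Longrightarrow> ?R s0 T \<le> g * T + C"
      using path_reward_rate_le[where r = r and h = h, OF r g h] s0 by blast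
    show "average_reward r \<le> g"
      unfolding avg by (rule tendsto_le[OF _ limC lim[OF s0] scale_le[OF C]]) simp
  next
    assume h: "\<And>s. s \<in> S \<Longrightarrow> g \<le> (\<Sum>s'\<in>S. q s s' * (r s s' + h s' - h s))"
    obtain C where C: "\<And>T. 0 \<le> T \<Longrightarrow> g * T - C \<le> ?R s0 T"
      using path_reward_rate_ge[where r = r and h = h, OF r g h] s0 by blast
    show "g \<le> average_reward r"
      unfolding avg by (rule tendsto_le[OF _ lim[OF s0] limC scale_ge[OF C]]) simp
  }
qed

end

section \<open>Generator of the tandem queue\<close>

text \<open>Used for \<open>0 \<le> left_lim F a\<close>, by which the rate of entering customers is
  at most \<Lambda>.\<close>

lemma left_lim_cdf:
  assumes "real_distribution D"
  shows "left_lim (cdf D) a = measure D {..<a}"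
proof -
  interpret real_distribution D by (rule assms)
  show ?thesis
    unfolding left_lim_def by (intro tendsto_Lim cdf_at_left) simp
qed

locale tandem =
  fixes J :: nat and \<mu> :: "nat \<Rightarrow> real"
  assumes J_pos: "1 \<le> J" and mu_pos: "\<And>j. j \<in> {1..J} \<Longrightarrow> 0 < \<mu> j"
begin

text \<open>The mean service time still ahead of a customer at station \<open>j\<close>. Beyond the
  last station the sum is empty and the value is 0.\<close>

definition residual :: "nat \<Rightarrow> real" where
  "residual j = (\<Sum>i=j..J. 1 / \<mu> i)"

text \<open>
  The expected total remaining service time of the customers present. Every server in operation
  decreases it at unit rate, whatever the buffer sizes are.
\<close>

definition workload :: "state \<Rightarrow> real" where
  "workload s = (\<Sum>j=1..J. residual j * real (s j))"

definition empty_state :: state where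
  "empty_state = (\<lambda>j\<in>{1..J}. 0)"

lemma residual_step: "j \<le> J \<Longrightarrow> residual j = 1 / \<mu> j + residual (Suc j)"
  unfolding residual_def by (rule sum.atLeast_Suc_atMost)

lemma residual_nonneg: "1 \<le> j \<Longrightarrow> 0 \<le> residual j"
  unfolding residual_def by (intro sum_nonneg) (auto intro!: less_imp_le[OF mu_pos])

lemma inverse_rate_le: "j \<in> {1..J} \<Longrightarrow> 1 / \<mu> j \<le> residual 1"
  unfolding residual_def
  by (rule member_le_sum[where f = "\<lambda>i. 1 / \<mu> i"]) (auto intro!: less_imp_le[OF mu_pos])

lemma residual_pos: "0 < residual 1"
  using inverse_rate_le[of 1] mu_pos[of 1] J_pos by (auto intro: less_le_trans[rotated])

lemma workload_arrive: "workload (arrive s) = workload s + residual 1"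
proof -
  have "workload (arrive s) - workload s = (\<Sum>j=1..J. if j = 1 then residual j else 0)"
    unfolding workload_def sum_subtractf[symmetric]
    by (intro sum.cong) (auto simp: arrive_def algebra_simps)
  then show ?thesis using J_pos by (simp add: sum.delta)
qed

text \<open>The served customer moves on and contributes \<open>residual (Suc j)\<close> instead of
  \<open>residual j\<close>. A departure from station \<open>J\<close> is included, as
  \<open>residual (Suc J) = 0\<close>.\<close>

lemma workload_serve:
  assumes j: "j \<in> {1..J}" and s: "0 < s j"
  shows "workload (serve J j s) = workload s - 1 / \<mu> j"
proof -
  have "workload (serve J j s) - workload s =
    (\<Sum>i=1..J. (if i = Suc j then residual i else 0) - (if i = j then residual i else 0))"
    unfolding workload_def sum_subtractf[symmetric]
    using s j by (intro sum.cong) (auto simp: serve_def algebra_simps of_nat_diff)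
  also have "\<dots> = (if Suc j \<le> J then residual (Suc j) else 0) - residual j"
    using j by (simp add: sum_subtractf sum.delta)
  also have "(if Suc j \<le> J then residual (Suc j) else 0) = residual (Suc j)"
    by (simp add: residual_def)
  finally show ?thesis using residual_step[of j] j by simp
qed

lemma workload_nonneg: "0 \<le> workload s"
  unfolding workload_def by (intro sum_nonneg mult_nonneg_nonneg residual_nonneg) auto

lemma workload_ge_first: "residual 1 * real (s 1) \<le> workload s"
  unfolding workload_def
  using J_pos by (intro member_le_sum[where f = "\<lambda>j. residual j * real (s j)"])
    (simp_all add: residual_nonneg)

lemma workload_empty: "workload empty_state = 0"
  by (simp add: workload_def empty_state_def)

lemma state_space_iff:
  "s \<in> state_space J B \<longleftrightarrow> (\<forall>j\<in>{1..J}. s j \<le> B j + 1) \<and> (\<forall>j. j \<notin> {1..J} \<longrightarrow> s j = undefined)"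
  by (auto simp: state_space_def PiE_iff extensional_def)

lemma finite_state_space: "finite (state_space J B)"
  unfolding state_space_def by (intro finite_PiE) auto

lemma empty_in_state_space: "empty_state \<in> state_space J B"
  by (auto simp: state_space_iff empty_state_def)

lemma arrive_in_iff: "s \<in> state_space J B \<Longrightarrow> arrive s \<in> state_space J B \<longleftrightarrow> s 1 \<le> B 1"
  using J_pos by (auto simp: state_space_iff arrive_def)

text \<open>The last nonempty station is never blocked.\<close>

lemma ex_active:
  assumes s: "s \<in> state_space J B" and ne: "s \<noteq> empty_state"
  obtains j where "j \<in> {1..J}" "0 < s j" "serve J j s \<in> state_space J B"
proof -
  let ?N = "{j\<in>{1..J}. 0 < s j}"
  have "?N \<noteq> {}"
  proof
    assume "?N = {}"
    then have "s i = empty_state i" for i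
      using s by (auto simp: state_space_iff empty_state_def)
    with ne show False by auto
  qed
  then have j: "Max ?N \<in> ?N" by (intro Max_in) auto
  \<comment> \<open>Everything downstream of the last nonempty station is empty, so the customer
    moved there is alone, and every station holds at least one.\<close>
  have zero: "s i = 0" if "i \<in> {1..J}" "Max ?N < i" for i
    using that Max_ge[of ?N i] by fastforce
  have "serve J (Max ?N) s \<in> state_space J B"
    unfolding state_space_iff
  proof (intro conjI ballI allI impI)
    fix i assume i: "i \<in> {1..J}"
    have "s i \<le> B i + 1" using s i by (auto simp: state_space_iff)
    then show "serve J (Max ?N) s i \<le> B i + 1"
      using zero[of "Suc (Max ?N)"] i by (auto simp: serve_def)
  next
    fix i assume "i \<notin> {1..J}"
    then show "serve J (Max ?N) s i = undefined"
      using s j by (auto simp: serve_def state_space_iff)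
  qed
  with j show ?thesis using that by blast
qed

text \<open>Only an arrival raises the count at station 1; hence no service completion earns a
  reward.\<close>

lemma serve_neq_arrive: "j \<in> {1..J} \<Longrightarrow> serve J j s \<noteq> arrive s"
proof
  assume j: "j \<in> {1..J}" and "serve J j s = arrive s"
  then have "serve J j s 1 = arrive s 1" by simp
  with j show False by (auto simp: serve_def arrive_def split: if_splits)
qed

text \<open>Exchanging the two sums evaluates each event at its single target. The membership tests
  that remain express lost arrivals and blocking.\<close>

lemma sum_queue_rate:
  "(\<Sum>s'\<in>state_space J B. queue_rate J \<mu> \<Lambda> F \<pi> s s' * \<phi> s') =
     (if arrive s \<in> state_space J B then \<Lambda> * (1 - left_lim F (\<pi> s)) * \<phi> (arrive s) else 0)
     + (\<Sum>j\<in>{1..J}. if 0 < s j \<and> serve J j s \<in> state_space J B then \<mu> j * \<phi> (serve J j s) else 0)"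
proof -
  let ?S = "state_space J B"
  have "(\<Sum>s'\<in>?S. (if s' = arrive s then \<Lambda> * (1 - left_lim F (\<pi> s)) else 0) * \<phi> s') =
    (\<Sum>s'\<in>?S. if s' = arrive s then \<Lambda> * (1 - left_lim F (\<pi> s)) * \<phi> s' else 0)"
    by (intro sum.cong) auto
  also have "\<dots> = (if arrive s \<in> ?S then \<Lambda> * (1 - left_lim F (\<pi> s)) * \<phi> (arrive s) else 0)"
    using finite_state_space by (simp add: sum.delta)
  finally have 1: "(\<Sum>s'\<in>?S. (if s' = arrive s then \<Lambda> * (1 - left_lim F (\<pi> s)) else 0) * \<phi> s') = \<dots>" .
  have "(\<Sum>s'\<in>?S. (\<Sum>j\<in>{1..J}. if 0 < s j \<and> s' = serve J j s then \<mu> j else 0) * \<phi> s') =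
    (\<Sum>j\<in>{1..J}. \<Sum>s'\<in>?S. (if 0 < s j \<and> s' = serve J j s then \<mu> j else 0) * \<phi> s')"
    unfolding sum_distrib_right by (rule sum.swap)
  also have "\<dots> = (\<Sum>j\<in>{1..J}. if 0 < s j \<and> serve J j s \<in> ?S then \<mu> j * \<phi> (serve J j s) else 0)"
  proof (intro sum.cong refl)
    fix j
    have "(\<Sum>s'\<in>?S. (if 0 < s j \<and> s' = serve J j s then \<mu> j else 0) * \<phi> s') =
      (\<Sum>s'\<in>?S. if s' = serve J j s then (if 0 < s j then \<mu> j * \<phi> s' else 0) else 0)"
      by (intro sum.cong) auto
    then show "(\<Sum>s'\<in>?S. (if 0 < s j \<and> s' = serve J j s then \<mu> j else 0) * \<phi> s') =
      (if 0 < s j \<and> serve J j s \<in> ?S then \<mu> j * \<phi> (serve J j s) else 0)"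
      using finite_state_space by (simp add: sum.delta)
  qed
  finally show ?thesis
    using 1 by (simp add: queue_rate_def distrib_right sum.distrib)
qed

text \<open>
  For \<open>f\<close> increasing, keeping only one of the busy servers gives an upper bound for the drift of
  \<open>f\<close> of the workload; by \<open>ex_active\<close> there is one in every nonempty state.
\<close>

lemma workload_drift_le:
  assumes s: "s \<in> state_space J B" and ne: "s \<noteq> empty_state" and f: "mono f"
    and l: "0 \<le> \<Lambda> * (1 - left_lim F (\<pi> s))" "\<Lambda> * (1 - left_lim F (\<pi> s)) \<le> \<alpha>"
  shows "\<exists>j\<in>{1..J}.
    (\<Sum>s'\<in>state_space J B. queue_rate J \<mu> \<Lambda> F \<pi> s s' * (f (workload s') - f (workload s)))
       \<le> \<alpha> * (f (workload s + residual 1) - f (workload s))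
         + \<mu> j * (f (workload s - 1 / \<mu> j) - f (workload s) :: real)"
proof -
  obtain j where j: "j \<in> {1..J}" "0 < s j" "serve J j s \<in> state_space J B"
    using ex_active[OF s ne] .
  let ?t = "\<lambda>i. if 0 < s i \<and> serve J i s \<in> state_space J B
    then \<mu> i * (f (workload (serve J i s)) - f (workload s)) else 0"
  have t: "?t i \<le> 0" if i: "i \<in> {1..J}" for i
  proof (cases "0 < s i")
    case True
    have "f (workload (serve J i s)) \<le> f (workload s)"
      using mu_pos[OF i] by (intro monoD[OF f]) (simp add: workload_serve[where s = s, OF i True])
    then show ?thesis using mu_pos[OF i] by (simp add: mult_nonneg_nonpos)
  qed simp
  have "(\<Sum>i\<in>{1..J}. ?t i) = ?t j + (\<Sum>i\<in>{1..J} - {j}. ?t i)"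
    using j(1) by (intro sum.remove) auto
  also have "\<dots> \<le> ?t j"
  proof -
    have "(\<Sum>i\<in>{1..J} - {j}. ?t i) \<le> 0"
      by (intro sum_nonpos t) auto
    then show ?thesis by linarith
  qed
  also have "\<dots> = \<mu> j * (f (workload s - 1 / \<mu> j) - f (workload s))"
    using j by (simp add: workload_serve)
  finally have serve: "(\<Sum>i\<in>{1..J}. ?t i) \<le> \<mu> j * (f (workload s - 1 / \<mu> j) - f (workload s))" .
  have "0 \<le> f (workload s + residual 1) - f (workload s)"
    using monoD[OF f, of "workload s" "workload s + residual 1"] residual_pos by simp
  then have "(if arrive s \<in> state_space J B
      then \<Lambda> * (1 - left_lim F (\<pi> s)) * (f (workload (arrive s)) - f (workload s)) else 0)
      \<le> \<alpha> * (f (workload s + residual 1) - f (workload s))"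
    using l by (auto simp: workload_arrive intro: mult_right_mono mult_nonneg_nonneg)
  with serve have "(\<Sum>s'\<in>state_space J B. queue_rate J \<mu> \<Lambda> F \<pi> s s' * (f (workload s') - f (workload s)))
       \<le> \<alpha> * (f (workload s + residual 1) - f (workload s))
         + \<mu> j * (f (workload s - 1 / \<mu> j) - f (workload s) :: real)"
    unfolding sum_queue_rate by (rule add_mono[rotated])
  with j(1) show ?thesis by blast
qed

text \<open>Splits the expression in the gain bounds into the revenue rate of the state and the
  generator applied to \<open>h\<close>.\<close>

lemma sum_queue_rate_reward:
  "(\<Sum>s'\<in>state_space J B. queue_rate J \<mu> \<Lambda> F \<pi> s s' * (reward \<pi> s s' + h s' - h s)) =
     (if arrive s \<in> state_space J B then \<Lambda> * (1 - left_lim F (\<pi> s)) * \<pi> s else 0)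
     + (\<Sum>s'\<in>state_space J B. queue_rate J \<mu> \<Lambda> F \<pi> s s' * (h s' - h s))"
proof -
  have "(\<Sum>s'\<in>state_space J B. queue_rate J \<mu> \<Lambda> F \<pi> s s' * (reward \<pi> s s' + h s' - h s)) =
    (\<Sum>s'\<in>state_space J B. queue_rate J \<mu> \<Lambda> F \<pi> s s' * reward \<pi> s s')
     + (\<Sum>s'\<in>state_space J B. queue_rate J \<mu> \<Lambda> F \<pi> s s' * (h s' - h s))"
    by (simp add: sum.distrib[symmetric] algebra_simps)
  moreover have "(\<Sum>s'\<in>state_space J B. queue_rate J \<mu> \<Lambda> F \<pi> s s' * reward \<pi> s s') =
    (if arrive s \<in> state_space J B then \<Lambda> * (1 - left_lim F (\<pi> s)) * \<pi> s else 0)"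
  proof -
    have "(\<Sum>j\<in>{1..J}. if 0 < s j \<and> serve J j s \<in> state_space J B
        then \<mu> j * reward \<pi> s (serve J j s) else 0) = 0"
      by (intro sum.neutral) (auto simp: reward_def serve_neq_arrive)
    then show ?thesis
      unfolding sum_queue_rate by (simp add: reward_def)
  qed
  ultimately show ?thesis by simp
qed

end

section \<open>Bounds for the gain\<close>

text \<open>To first order in \<theta> the expression is \<open>- \<theta> * \<eta>\<close>, where
  \<eta> is the spare capacity \<open>1 - \<alpha> * m\<close>. With
  \<open>\<theta> * m = \<eta> / 4\<close> each of the two quadratic remainders is at most
  \<open>\<theta> * \<eta> / 4\<close>, which leaves half of the drift. The variable
  \<open>x\<close> stands for a mean service time \<open>1 / \<mu> j\<close>; uniformity in
  \<open>x\<close> covers whichever server is active.\<close>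

lemma exponential_drift:
  fixes m \<alpha> :: real
  assumes m: "0 < m" and \<alpha>: "0 \<le> \<alpha>" and load: "\<alpha> * m < 1"
  obtains \<theta> \<delta> where "0 < \<theta>" "0 < \<delta>"
    "\<And>x. 0 < x \<Longrightarrow> x \<le> m \<Longrightarrow> \<alpha> * (exp (\<theta> * m) - 1) + (exp (- \<theta> * x) - 1) / x \<le> - \<delta>"
proof -
  define \<eta> where "\<eta> = 1 - \<alpha> * m"
  have \<eta>: "0 < \<eta>" "\<eta> \<le> 1" using load m \<alpha> by (auto simp: \<eta>_def)
  define \<theta> where "\<theta> = \<eta> / (4 * m)"
  have \<theta>: "0 < \<theta>" using \<eta> m by (simp add: \<theta>_def)
  have \<theta>m: "\<theta> * m = \<eta> / 4" using m by (simp add: \<theta>_def)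
  have drift: "\<alpha> * (exp (\<theta> * m) - 1) + (exp (- \<theta> * x) - 1) / x \<le> - (\<theta> * \<eta> / 2)" if x: "0 < x" "x \<le> m" for x
  proof -
  have "exp (\<theta> * m) \<le> 1 + \<theta> * m + (\<theta> * m)\<^sup>2"
    unfolding \<theta>m using \<eta> by (intro exp_bound) auto
  then have "\<alpha> * (exp (\<theta> * m) - 1) \<le> \<alpha> * (\<theta> * m + (\<theta> * m)\<^sup>2)"
    using \<alpha> by (intro mult_left_mono) auto
  also have "\<dots> = \<alpha> * m * \<theta> + \<alpha> * m * (\<theta> * (\<theta> * m))"
    by (simp add: power2_eq_square algebra_simps)
  also have "\<dots> \<le> \<alpha> * m * \<theta> + 1 * (\<theta> * (\<theta> * m))"
    using load \<theta> m by (intro add_left_mono mult_right_mono mult_nonneg_nonneg) auto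
  finally have up: "\<alpha> * (exp (\<theta> * m) - 1) \<le> (1 - \<eta>) * \<theta> + \<theta> * (\<eta> / 4)"
    unfolding \<theta>m by (simp add: \<eta>_def)
  \<comment> \<open>Multiplied by \<open>1 + y\<close>, the left-hand side is at most 1 and the
    right-hand side is \<open>1 + y^3\<close>.\<close>
  have exp_neg: "exp (- y) \<le> 1 - y + y\<^sup>2" if "0 \<le> y" for y :: real
  proof -
    have "exp (- y) * (1 + y) \<le> exp (- y) * exp y"
      by (intro mult_left_mono exp_ge_add_one_self) auto
    also have "\<dots> = 1" by (simp add: exp_add[symmetric])
    also have "\<dots> \<le> (1 - y + y\<^sup>2) * (1 + y)"
      using that by (simp add: power2_eq_square algebra_simps)
    finally show ?thesis using that by (simp add: mult_le_cancel_right)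
  qed
  have "exp (- \<theta> * x) - 1 \<le> - (\<theta> * x) + (\<theta> * x)\<^sup>2"
  proof -
    have "0 \<le> \<theta> * x" using \<theta> x by (intro mult_nonneg_nonneg) auto
    from exp_neg[OF this] show ?thesis by simp
  qed
  also have "\<dots> = (- \<theta> + \<theta> * (\<theta> * x)) * x"
    by (simp add: power2_eq_square algebra_simps)
  also have "\<dots> \<le> (- \<theta> + \<theta> * (\<theta> * m)) * x"
    using \<theta> x by (intro mult_right_mono add_left_mono mult_left_mono) auto
  finally have "(exp (- \<theta> * x) - 1) / x \<le> - \<theta> + \<theta> * (\<eta> / 4)"
    unfolding \<theta>m using x by (simp add: pos_divide_le_eq)
  with up show ?thesis
    by (simp add: left_diff_distrib mult.commute[of \<theta> \<eta>])
  qed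
  show ?thesis
    by (rule that[of \<theta> "\<theta> * \<eta> / 2"]) (use \<theta> \<eta> drift in auto)
qed

section \<open>The gain of a pricing policy in the tandem queue\<close>

locale priced_tandem = tandem +
  fixes \<Lambda> :: real and F :: "real \<Rightarrow> real" and A :: "real set" and B :: "nat \<Rightarrow> nat"
  assumes arrival_pos: "0 < \<Lambda>"
    and prices_nonneg: "A \<subseteq> {0..}"
    and left_lim_nonneg: "\<And>a. 0 \<le> left_lim F a"
    and left_lim_less: "\<And>a. a \<in> A \<Longrightarrow> left_lim F a < 1"
    and load: "\<Lambda> * residual 1 < 1"
begin

abbreviation "rate a \<equiv> \<Lambda> * (1 - left_lim F a)"

lemma rate_pos: "a \<in> A \<Longrightarrow> 0 < rate a"
  using arrival_pos left_lim_less by simp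

lemma rate_le: "rate a \<le> \<Lambda>"
  using arrival_pos left_lim_nonneg[of a] by (simp add: mult_left_le)

lemma policy_in: "\<pi> \<in> policies J B A \<Longrightarrow> s \<in> state_space J B \<Longrightarrow> \<pi> s \<in> A"
  by (auto simp: policies_def)

lemma static_policy_in: "a \<in> A \<Longrightarrow> static_policy J B a \<in> policies J B A"
  by (auto simp: policies_def static_policy_def)

lemma queue_rate_nonneg:
  assumes "\<pi> \<in> policies J B A" "s \<in> state_space J B"
  shows "0 \<le> queue_rate J \<mu> \<Lambda> F \<pi> s s'"
  unfolding queue_rate_def using rate_pos[OF policy_in[OF assms]]
  by (intro add_nonneg_nonneg sum_nonneg) (auto intro!: less_imp_le mu_pos)

text \<open>No state is absorbing: the empty state admits an arrival, which has positive rate at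
  every allowed price, and any other state has an unblocked busy server.\<close>

lemma finite_chain_queue:
  assumes \<pi>: "\<pi> \<in> policies J B A"
  shows "finite_chain (state_space J B) (queue_rate J \<mu> \<Lambda> F \<pi>)"
proof
  show "finite (state_space J B)" by (rule finite_state_space)
next
  fix s assume s: "s \<in> state_space J B"
  let ?a = "if arrive s \<in> state_space J B then rate (\<pi> s) else 0"
  let ?t = "\<lambda>j. if 0 < s j \<and> serve J j s \<in> state_space J B then \<mu> j else 0"
  have exit: "exit_rate (state_space J B) (queue_rate J \<mu> \<Lambda> F \<pi>) s = ?a + (\<Sum>j\<in>{1..J}. ?t j)"
    using sum_queue_rate[where \<phi> = "\<lambda>_. 1" and B = B and \<pi> = \<pi> and s = s and \<Lambda> = \<Lambda> and F = F]
    by (simp add: exit_rate_def cong: if_cong)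
  have a: "0 \<le> ?a" using rate_pos[OF policy_in[OF \<pi> s]] by simp
  have t: "0 \<le> ?t j" if "j \<in> {1..J}" for j using mu_pos[OF that] by simp
  show "0 < exit_rate (state_space J B) (queue_rate J \<mu> \<Lambda> F \<pi>) s"
  proof (cases "s = empty_state")
    case True
    then have "arrive s \<in> state_space J B"
      using s J_pos by (simp add: arrive_in_iff) (simp add: empty_state_def)
    moreover have "0 \<le> (\<Sum>j\<in>{1..J}. ?t j)" by (intro sum_nonneg t)
    ultimately show ?thesis
      unfolding exit using rate_pos[OF policy_in[OF \<pi> s]] by simp
  next
    case False
    then obtain j where j: "j \<in> {1..J}" "0 < s j" "serve J j s \<in> state_space J B"
      using ex_active[OF s] by blast
    have "?t j \<le> (\<Sum>j\<in>{1..J}. ?t j)"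
      using j t by (intro member_le_sum) auto
    moreover have "0 < ?t j" using j mu_pos by simp
    ultimately show ?thesis unfolding exit using a by linarith
  qed
qed (intro queue_rate_nonneg \<pi>)

lemma gain_eq_average_reward:
  assumes \<pi>: "\<pi> \<in> policies J B A"
  shows "gain J \<mu> \<Lambda> F B \<pi> =
    finite_chain.average_reward (state_space J B) (queue_rate J \<mu> \<Lambda> F \<pi>) (reward \<pi>)"
proof -
  interpret finite_chain "state_space J B" "queue_rate J \<mu> \<Lambda> F \<pi>"
    by (rule finite_chain_queue[OF \<pi>])
  show ?thesis
    unfolding gain_def average_reward_def expected_revenue_def path_reward_def ctmc_space_def ..
qed

text \<open>Entry rates never exceed \<Lambda>, so under every policy the workload drifts down at
  rate at least \<open>1 - \<Lambda> * residual 1\<close> away from the empty state. Dividing by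
  this number gives the Lyapunov function \<open>w\<close> with drift at most -1.\<close>

lemma
  assumes \<pi>: "\<pi> \<in> policies J B A" and g: "0 \<le> g"
  shows gain_le: "(\<And>s. s \<in> state_space J B \<Longrightarrow>
      (\<Sum>s'\<in>state_space J B. queue_rate J \<mu> \<Lambda> F \<pi> s s' * (reward \<pi> s s' + h s' - h s)) \<le> g)
      \<Longrightarrow> gain J \<mu> \<Lambda> F B \<pi> \<le> g"
    and gain_ge: "(\<And>s. s \<in> state_space J B \<Longrightarrow>
      g \<le> (\<Sum>s'\<in>state_space J B. queue_rate J \<mu> \<Lambda> F \<pi> s s' * (reward \<pi> s s' + h s' - h s)))
      \<Longrightarrow> g \<le> gain J \<mu> \<Lambda> F B \<pi>"
proof -
  let ?S = "state_space J B" and ?q = "queue_rate J \<mu> \<Lambda> F \<pi>"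
  interpret finite_chain ?S ?q
    by (rule finite_chain_queue[OF \<pi>])
  define w where "w s = workload s / (1 - \<Lambda> * residual 1)" for s
  have w: "0 \<le> w s" for s
    using load workload_nonneg by (simp add: w_def)
  have drift: "(\<Sum>s'\<in>?S. ?q s s' * (w s' - w s)) \<le> -1" if s: "s \<in> ?S" "s \<noteq> empty_state" for s
  proof -
    obtain j where j: "j \<in> {1..J}" and le: "(\<Sum>s'\<in>?S. ?q s s' * (workload s' - workload s))
       \<le> \<Lambda> * (workload s + residual 1 - workload s) + \<mu> j * (workload s - 1 / \<mu> j - workload s)"
      using workload_drift_le[where f = "\<lambda>x. x" and \<Lambda> = \<Lambda> and F = F and \<pi> = \<pi> and \<alpha> = \<Lambda>, OF s monoI
          less_imp_le[OF rate_pos[OF policy_in[OF \<pi> s(1)]]] rate_le] by blast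
    have "\<mu> j * (workload s - 1 / \<mu> j - workload s) = - 1"
      using mu_pos[OF j] by simp
    with le have "(\<Sum>s'\<in>?S. ?q s s' * (workload s' - workload s)) \<le> - (1 - \<Lambda> * residual 1)"
      by simp
    moreover have "(\<Sum>s'\<in>?S. ?q s s' * (w s' - w s)) =
        (\<Sum>s'\<in>?S. ?q s s' * (workload s' - workload s)) / (1 - \<Lambda> * residual 1)"
      unfolding w_def sum_divide_distrib by (simp add: diff_divide_distrib[symmetric])
    ultimately show ?thesis
      using load by (simp add: pos_divide_le_eq)
  qed
  have r: "0 \<le> reward \<pi> s s'" if "s \<in> ?S" for s s'
    using policy_in[OF \<pi> that] prices_nonneg by (auto simp: reward_def)
  show "gain J \<mu> \<Lambda> F B \<pi> \<le> g"
    if "\<And>s. s \<in> ?S \<Longrightarrow> (\<Sum>s'\<in>?S. ?q s s' * (reward \<pi> s s' + h s' - h s)) \<le> g"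
    unfolding gain_eq_average_reward[OF \<pi>]
    by (rule average_reward_le[where w = w and h = h, OF w drift empty_in_state_space r g that])
  show "g \<le> gain J \<mu> \<Lambda> F B \<pi>"
    if "\<And>s. s \<in> ?S \<Longrightarrow> g \<le> (\<Sum>s'\<in>?S. ?q s s' * (reward \<pi> s s' + h s' - h s))"
    unfolding gain_eq_average_reward[OF \<pi>]
    by (rule average_reward_ge[where w = w and h = h, OF w drift empty_in_state_space r g that])
qed

text \<open>With \<open>h = 0\<close> the generator sum is the revenue rate of the current state: 0
  if station 1 is full, and otherwise price times entry rate.\<close>

lemma gain_le_max_revenue_rate:
  assumes \<pi>: "\<pi> \<in> policies J B A" and G: "0 \<le> G" and max: "\<And>a. a \<in> A \<Longrightarrow> a * rate a \<le> G"
  shows "gain J \<mu> \<Lambda> F B \<pi> \<le> G"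
proof (rule gain_le[where h = "\<lambda>_. 0", OF \<pi> G])
  fix s assume s: "s \<in> state_space J B"
  show "(\<Sum>s'\<in>state_space J B. queue_rate J \<mu> \<Lambda> F \<pi> s s' * (reward \<pi> s s' + 0 - 0)) \<le> G"
    using sum_queue_rate_reward[where h = "\<lambda>_. 0" and B = B and \<pi> = \<pi> and s = s and \<Lambda> = \<Lambda> and F = F]
      max[OF policy_in[OF \<pi> s]] G
    by (simp add: mult.commute)
qed

text \<open>
  \<open>x * exp (\<theta> * workload)\<close> compensates the revenue lost while station 1 is full, where the workload
  is at least \<open>residual 1 * (B 1 + 1)\<close>; the factor \<open>x\<close> is exponentially small in \<open>B 1\<close>.
\<close>

lemma gain_static_ge:
  assumes a: "a \<in> A" and \<theta>: "0 < \<theta>" and \<delta>: "0 < \<delta>"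
    and drift: "\<And>x. 0 < x \<Longrightarrow> x \<le> residual 1 \<Longrightarrow>
      rate a * (exp (\<theta> * residual 1) - 1) + (exp (- \<theta> * x) - 1) / x \<le> - \<delta>"
    and c: "c = (rate a * (exp (\<theta> * residual 1) - 1) + \<delta>) / \<delta>"
    and small: "c * exp (- \<theta> * residual 1) ^ (B 1 + 1) \<le> 1"
  shows "a * rate a * (1 - c * exp (- \<theta> * residual 1) ^ (B 1 + 1)) \<le> gain J \<mu> \<Lambda> F B (static_policy J B a)"
proof -
  let ?S = "state_space J B" and ?\<pi> = "static_policy J B a"
  let ?q = "queue_rate J \<mu> \<Lambda> F ?\<pi>"
  define K where "K = rate a * (exp (\<theta> * residual 1) - 1)"
  define E where "E = exp (\<theta> * residual 1 * real (B 1 + 1))"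
  define G where "G = a * rate a"
  define V where "V s = exp (\<theta> * workload s)" for s
  \<comment> \<open>Chosen so that \<open>x * \<delta> * E = G\<close>: once \<open>V s\<close>
    reaches \<open>E\<close>, its lower bound when station 1 is full, the compensation equals the
    lost revenue rate.\<close>
  define x where "x = G / (\<delta> * E)"
  have E: "0 < E" by (simp add: E_def)
  have pow: "exp (- \<theta> * residual 1) ^ (B 1 + 1) = 1 / E"
    unfolding exp_of_nat_mult[symmetric] E_def
    by (simp only: exp_minus[symmetric] inverse_eq_divide[symmetric]) (simp add: mult_ac)
  have G0: "0 \<le> G"
    using rate_pos[OF a] a prices_nonneg by (auto simp: G_def)
  have x0: "0 \<le> x" using G0 \<delta> E by (simp add: x_def)
  have K0: "0 \<le> K"
    using rate_pos[OF a] \<theta> residual_pos by (auto simp: K_def intro!: mult_nonneg_nonneg)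
  have price: "?\<pi> s = a" if "s \<in> ?S" for s
    using that by (simp add: static_policy_def)
  \<comment> \<open>In the empty state \<open>V\<close> is 1 and its drift is at most
    \<open>K\<close>; elsewhere the drift is at most \<open>- \<delta> * V s\<close>. The bound
    covers both.\<close>
  have V_drift: "(\<Sum>s'\<in>?S. ?q s s' * (V s' - V s)) \<le> K + \<delta> - \<delta> * V s" if s: "s \<in> ?S" for s
  proof (cases "s = empty_state")
    case True
    have "(\<Sum>j\<in>{1..J}. if 0 < s j \<and> serve J j s \<in> ?S then \<mu> j * (V (serve J j s) - V s) else 0) = 0"
      using True by (intro sum.neutral) (auto simp: empty_state_def)
    moreover have "V s = 1" "V (arrive s) = exp (\<theta> * residual 1)"
      using True by (simp_all add: V_def workload_empty workload_arrive)
    ultimately show ?thesis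
      unfolding sum_queue_rate using K0 price[OF s] by (simp add: K_def)
  next
    case False
    have f: "mono (\<lambda>y. exp (\<theta> * y))"
      using \<theta> by (intro monoI) simp
    have l: "0 \<le> rate (?\<pi> s)" "rate (?\<pi> s) \<le> rate a"
      using price[OF s] rate_pos[OF a] by simp_all
    obtain j where j: "j \<in> {1..J}" and le: "(\<Sum>s'\<in>?S. ?q s s' * (V s' - V s)) \<le>
        rate a * (exp (\<theta> * (workload s + residual 1)) - exp (\<theta> * workload s))
         + \<mu> j * (exp (\<theta> * (workload s - 1 / \<mu> j)) - exp (\<theta> * workload s))"
      unfolding V_def
      using workload_drift_le[where f = "\<lambda>y. exp (\<theta> * y)" and \<Lambda> = \<Lambda> and F = F and \<pi> = ?\<pi>, OF s False f l]
      by blast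
    note le
    also have "rate a * (exp (\<theta> * (workload s + residual 1)) - exp (\<theta> * workload s))
         + \<mu> j * (exp (\<theta> * (workload s - 1 / \<mu> j)) - exp (\<theta> * workload s))
      = V s * (rate a * (exp (\<theta> * residual 1) - 1) + (exp (- \<theta> * (1 / \<mu> j)) - 1) / (1 / \<mu> j))"
    proof -
      have "exp (\<theta> * (workload s + residual 1)) = V s * exp (\<theta> * residual 1)"
        "exp (\<theta> * (workload s - 1 / \<mu> j)) = V s * exp (- \<theta> * (1 / \<mu> j))"
        unfolding V_def exp_add[symmetric] by (simp_all add: algebra_simps)
      then show ?thesis
        by (simp only: V_def[symmetric]) (simp add: algebra_simps)
    qed
    also have "\<dots> \<le> V s * - \<delta>"
      using mu_pos[OF j] inverse_rate_le[OF j] by (intro mult_left_mono drift) (auto simp: V_def)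
    finally show ?thesis using K0 \<delta> by (simp add: mult.commute)
  qed
  have xE: "x * (\<delta> * E) = G" using \<delta> E by (simp add: x_def)
  \<comment> \<open>The price of the compensation, paid in every state; relative to \<open>G\<close>
    it is the claimed exponentially small loss.\<close>
  have xK: "x * (K + \<delta>) = G * (c * (1 / E))"
  proof -
    have "c = (K + \<delta>) / \<delta>" by (simp only: c K_def)
    then show ?thesis using \<delta> E by (simp add: x_def)
  qed
  have "G * (1 - c * exp (- \<theta> * residual 1) ^ (B 1 + 1)) \<le> gain J \<mu> \<Lambda> F B ?\<pi>"
  proof (rule gain_ge[where h = "\<lambda>s. - (x * V s)"])
    show "?\<pi> \<in> policies J B A" by (rule static_policy_in[OF a])
    \<comment> \<open>Nonnegativity of the candidate gain is the use of
      \<open>small\<close>.\<close>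
    show "0 \<le> G * (1 - c * exp (- \<theta> * residual 1) ^ (B 1 + 1))"
      using small G0 by (intro mult_nonneg_nonneg) auto
    fix s assume s: "s \<in> ?S"
    have "(\<Sum>s'\<in>?S. ?q s s' * (- (x * V s') - - (x * V s))) = - (x * (\<Sum>s'\<in>?S. ?q s s' * (V s' - V s)))"
      by (simp add: sum_distrib_left sum_negf[symmetric] algebra_simps)
    moreover have "x * (\<Sum>s'\<in>?S. ?q s s' * (V s' - V s)) \<le> x * (K + \<delta> - \<delta> * V s)"
      by (intro mult_left_mono V_drift s x0)
    ultimately have QV: "- (x * (K + \<delta>)) + x * (\<delta> * V s) \<le> (\<Sum>s'\<in>?S. ?q s s' * (- (x * V s') - - (x * V s)))"
      by (simp add: right_diff_distrib)
    have "G \<le> (if arrive s \<in> ?S then G else 0) + x * (\<delta> * V s)"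
    proof (cases "arrive s \<in> ?S")
      case True
      then show ?thesis using x0 \<delta> by (simp add: V_def)
    next
      case False
      then have "real (B 1 + 1) \<le> real (s 1)"
        using s by (simp add: arrive_in_iff)
      then have "residual 1 * real (B 1 + 1) \<le> workload s"
        using workload_ge_first[of s] residual_pos
        by (meson less_imp_le mult_left_mono order_trans)
      then have "E \<le> V s"
        unfolding E_def V_def using \<theta> by (simp add: mult.assoc)
      then have "x * (\<delta> * E) \<le> x * (\<delta> * V s)"
        using x0 \<delta> by (intro mult_left_mono) auto
      with False show ?thesis by (simp add: xE)
    qed
    moreover have "(if arrive s \<in> ?S then rate (?\<pi> s) * ?\<pi> s else 0) = (if arrive s \<in> ?S then G else 0)"
      using price[OF s] by (simp add: G_def mult.commute)
    moreover have "G * (1 - c * exp (- \<theta> * residual 1) ^ (B 1 + 1)) = G - x * (K + \<delta>)"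
      unfolding pow xK by (simp add: right_diff_distrib)
    ultimately show "G * (1 - c * exp (- \<theta> * residual 1) ^ (B 1 + 1))
        \<le> (\<Sum>s'\<in>?S. ?q s s' * (reward ?\<pi> s s' + - (x * V s') - - (x * V s)))"
      unfolding sum_queue_rate_reward[where h = "\<lambda>s. - (x * V s)"] using QV by linarith
  qed
  then show ?thesis by (simp add: G_def)
qed

end

text \<open>That \<open>c\<close> and \<open>p\<close> depend only on the service rates and on
  \<alpha> is expressed by the order of quantifiers: \<alpha> is fixed first, while the arrival
  rate, prices, distribution and buffers come after the constants.\<close>

theorem corollary1:
  fixes J :: nat and \<mu> :: "nat \<Rightarrow> real" and \<alpha> :: real
  assumes "1 \<le> J" and "\<And>j. j \<in> {1..J} \<Longrightarrow> 0 < \<mu> j"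
  shows "\<exists>c p :: real. 0 < c \<and> 0 < p \<and> p < 1 \<and>
    (\<forall>(\<Lambda> :: real) (A :: real set) (D :: real measure) (F :: real \<Rightarrow> real) (a\<^sub>s :: real).
       0 < \<Lambda> \<longrightarrow>
       A \<subseteq> {0..} \<longrightarrow> (\<exists>a\<in>A. 0 < a) \<longrightarrow>
       real_distribution D \<longrightarrow> F = cdf D \<longrightarrow>
       \<Lambda> * (\<Sum>j\<in>{1..J}. 1 / \<mu> j) < 1 \<longrightarrow>
       (\<forall>a\<in>A. 1 - left_lim F a > 0) \<longrightarrow>
       is_arg_max (\<lambda>a. a * \<Lambda> * (1 - left_lim F a)) (\<lambda>a. a \<in> A) a\<^sub>s \<longrightarrow>
       \<alpha> = \<Lambda> * (1 - left_lim F a\<^sub>s) \<longrightarrow>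
       (\<forall>B :: nat \<Rightarrow> nat. \<forall>\<^sub>F b in sequentially.
          \<forall>\<pi>\<^sub>o \<pi>\<^sub>s.
            is_arg_max (gain J \<mu> \<Lambda> F (B(1 := b)))
              (\<lambda>\<pi>. \<pi> \<in> policies J (B(1 := b)) A) \<pi>\<^sub>o \<longrightarrow>
            is_arg_max (gain J \<mu> \<Lambda> F (B(1 := b)))
              (\<lambda>\<pi>. \<pi> \<in> static_policies J (B(1 := b)) A) \<pi>\<^sub>s \<longrightarrow>
            1 - c * p ^ (b - 1)
              \<le> gain J \<mu> \<Lambda> F (B(1 := b)) (static_policy J (B(1 := b)) a\<^sub>s)
                 / gain J \<mu> \<Lambda> F (B(1 := b)) \<pi>\<^sub>o \<and>
            gain J \<mu> \<Lambda> F (B(1 := b)) (static_policy J (B(1 := b)) a\<^sub>s)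
                 / gain J \<mu> \<Lambda> F (B(1 := b)) \<pi>\<^sub>o \<le> 1 \<and>
            1 - c * p ^ (b - 1)
              \<le> gain J \<mu> \<Lambda> F (B(1 := b)) \<pi>\<^sub>s / gain J \<mu> \<Lambda> F (B(1 := b)) \<pi>\<^sub>o \<and>
            gain J \<mu> \<Lambda> F (B(1 := b)) \<pi>\<^sub>s / gain J \<mu> \<Lambda> F (B(1 := b)) \<pi>\<^sub>o \<le> 1))"
proof -
  interpret tandem J \<mu> using assms by unfold_locales
  show ?thesis
  \<comment> \<open>The constants must be chosen before the data are known, so the bounds on
    \<alpha> that the hypotheses imply enter as a case distinction.\<close>
  proof (cases "0 \<le> \<alpha> \<and> \<alpha> * residual 1 < 1")
    case True
    obtain \<theta> \<delta> where \<theta>: "0 < \<theta>" and \<delta>: "0 < \<delta>"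
      and drift: "\<And>x. 0 < x \<Longrightarrow> x \<le> residual 1 \<Longrightarrow>
        \<alpha> * (exp (\<theta> * residual 1) - 1) + (exp (- \<theta> * x) - 1) / x \<le> - \<delta>"
      using exponential_drift[OF residual_pos] True by blast
    define c where "c = (\<alpha> * (exp (\<theta> * residual 1) - 1) + \<delta>) / \<delta>"
    define p where "p = exp (- \<theta> * residual 1)"
    have c: "0 < c"
      unfolding c_def using True \<theta> \<delta> residual_pos by (intro divide_pos_pos add_nonneg_pos mult_nonneg_nonneg) auto
    have p: "0 < p" "p < 1"
      using \<theta> residual_pos by (auto simp: p_def)
    have "(\<lambda>b. c * p ^ (b + 1)) \<longlonglongrightarrow> c * 0"
      using p by (intro tendsto_mult tendsto_const LIMSEQ_ignore_initial_segment LIMSEQ_realpow_zero) auto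
    \<comment> \<open>This is what "sufficiently large" means for the first buffer: the lower bound
      for the static gain is positive, so the ratios have positive denominators.\<close>
    then have ev: "\<forall>\<^sub>F b in sequentially. c * p ^ (b + 1) < 1"
      by (rule order_tendstoD) simp
    show ?thesis
    proof (intro exI conjI allI impI)
      fix \<Lambda> A D F a\<^sub>s B
      assume \<Lambda>: "(0::real) < \<Lambda>" and A: "A \<subseteq> {0..}" and pos: "\<exists>a\<in>A. 0 < a"
        and D: "real_distribution D" and F: "F = cdf D"
        and load: "\<Lambda> * (\<Sum>j\<in>{1..J}. 1 / \<mu> j) < 1"
        and enter: "\<forall>a\<in>A. 1 - left_lim F a > 0"
        and opt: "is_arg_max (\<lambda>a. a * \<Lambda> * (1 - left_lim F a)) (\<lambda>a. a \<in> A) a\<^sub>s"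
        and \<alpha>: "\<alpha> = \<Lambda> * (1 - left_lim F a\<^sub>s)"
      have as: "a\<^sub>s \<in> A" using opt by (simp add: is_arg_max_def)
      have max: "a * (\<Lambda> * (1 - left_lim F a)) \<le> a\<^sub>s * \<alpha>" if "a \<in> A" for a
        using opt that by (fastforce simp: is_arg_max_def \<alpha> not_less mult.assoc)
      obtain a where "a \<in> A" "0 < a" using pos by blast
      then have "0 < a * (\<Lambda> * (1 - left_lim F a))" using \<Lambda> enter by simp
      with max[OF \<open>a \<in> A\<close>] have G: "0 < a\<^sub>s * \<alpha>" by linarith
      show "\<forall>\<^sub>F b in sequentially. \<forall>\<pi>\<^sub>o \<pi>\<^sub>s.
            is_arg_max (gain J \<mu> \<Lambda> F (B(1 := b))) (\<lambda>\<pi>. \<pi> \<in> policies J (B(1 := b)) A) \<pi>\<^sub>o \<longrightarrow>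
            is_arg_max (gain J \<mu> \<Lambda> F (B(1 := b))) (\<lambda>\<pi>. \<pi> \<in> static_policies J (B(1 := b)) A) \<pi>\<^sub>s \<longrightarrow>
            1 - c * p ^ (b - 1)
              \<le> gain J \<mu> \<Lambda> F (B(1 := b)) (static_policy J (B(1 := b)) a\<^sub>s)
                 / gain J \<mu> \<Lambda> F (B(1 := b)) \<pi>\<^sub>o \<and>
            gain J \<mu> \<Lambda> F (B(1 := b)) (static_policy J (B(1 := b)) a\<^sub>s)
                 / gain J \<mu> \<Lambda> F (B(1 := b)) \<pi>\<^sub>o \<le> 1 \<and>
            1 - c * p ^ (b - 1)
              \<le> gain J \<mu> \<Lambda> F (B(1 := b)) \<pi>\<^sub>s / gain J \<mu> \<Lambda> F (B(1 := b)) \<pi>\<^sub>o \<and>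
            gain J \<mu> \<Lambda> F (B(1 := b)) \<pi>\<^sub>s / gain J \<mu> \<Lambda> F (B(1 := b)) \<pi>\<^sub>o \<le> 1"
        using ev
      proof (eventually_elim, intro allI impI)
        fix b \<pi>\<^sub>o \<pi>\<^sub>s
        let ?B = "B(1 := b)"
        let ?g = "gain J \<mu> \<Lambda> F ?B"
        assume small: "c * p ^ (b + 1) < 1"
          and o: "is_arg_max ?g (\<lambda>\<pi>. \<pi> \<in> policies J ?B A) \<pi>\<^sub>o"
          and s: "is_arg_max ?g (\<lambda>\<pi>. \<pi> \<in> static_policies J ?B A) \<pi>\<^sub>s"
        interpret priced_tandem J \<mu> \<Lambda> F A ?B
        proof
          show "0 \<le> left_lim F a" for a
            using left_lim_cdf[OF D] by (simp add: F)
        qed (use \<Lambda> A enter load in \<open>auto simp: residual_def\<close>)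
        let ?\<pi> = "static_policy J ?B a\<^sub>s"
        have o_in: "\<pi>\<^sub>o \<in> policies J ?B A" and s_in: "\<pi>\<^sub>s \<in> policies J ?B A"
          using o s static_policy_in by (auto simp: is_arg_max_def static_policies_def)
        have le1: "?g ?\<pi> \<le> ?g \<pi>\<^sub>s"
          using s as by (auto simp: is_arg_max_def static_policies_def not_less)
        have le2: "?g \<pi>\<^sub>s \<le> ?g \<pi>\<^sub>o"
          using o s_in by (auto simp: is_arg_max_def not_less)
        have le3: "?g \<pi>\<^sub>o \<le> a\<^sub>s * \<alpha>"
          using G max by (intro gain_le_max_revenue_rate o_in) auto
        have "a\<^sub>s * \<alpha> * (1 - c * p ^ (b + 1)) \<le> ?g ?\<pi>"
          using gain_static_ge[OF as \<theta> \<delta> drift[unfolded \<alpha>] c_def[unfolded \<alpha>]] small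
          by (simp add: p_def \<alpha>)
        \<comment> \<open>A full station 1 holds \<open>b + 1\<close> customers, hence the exponent
          obtained; the exponent \<open>b - 1\<close> gives a weaker bound, also with truncated
          subtraction.\<close>
        moreover have "p ^ (b + 1) \<le> p ^ (b - 1)"
          using p by (intro power_decreasing) auto
        then have "a\<^sub>s * \<alpha> * (1 - c * p ^ (b - 1)) \<le> a\<^sub>s * \<alpha> * (1 - c * p ^ (b + 1))"
          using G c by (intro mult_left_mono) auto
        moreover have "0 < a\<^sub>s * \<alpha> * (1 - c * p ^ (b + 1))"
          using small by (intro mult_pos_pos[OF G]) simp
        ultimately have lower: "a\<^sub>s * \<alpha> * (1 - c * p ^ (b - 1)) \<le> ?g ?\<pi>" and g_pos: "0 < ?g ?\<pi>"
          by linarith+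
        \<comment> \<open>The optimal gain enters only through its upper bound
          \<open>a\<^sub>s * \<alpha>\<close>, which replaces it in the denominator.\<close>
        have "1 - c * p ^ (b - 1) \<le> ?g ?\<pi> / (a\<^sub>s * \<alpha>)"
          using lower G by (simp add: pos_le_divide_eq mult.commute)
        also have "\<dots> \<le> ?g ?\<pi> / ?g \<pi>\<^sub>o"
          using g_pos le1 le2 le3 by (intro divide_left_mono) auto
        finally have "1 - c * p ^ (b - 1) \<le> ?g ?\<pi> / ?g \<pi>\<^sub>o" .
        moreover have "?g ?\<pi> / ?g \<pi>\<^sub>o \<le> ?g \<pi>\<^sub>s / ?g \<pi>\<^sub>o"
          using g_pos le1 le2 by (intro divide_right_mono) auto
        moreover have "?g \<pi>\<^sub>s / ?g \<pi>\<^sub>o \<le> 1"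
          using g_pos le1 le2 by simp
        ultimately show "1 - c * p ^ (b - 1) \<le> ?g ?\<pi> / ?g \<pi>\<^sub>o \<and> ?g ?\<pi> / ?g \<pi>\<^sub>o \<le> 1 \<and>
            1 - c * p ^ (b - 1) \<le> ?g \<pi>\<^sub>s / ?g \<pi>\<^sub>o \<and> ?g \<pi>\<^sub>s / ?g \<pi>\<^sub>o \<le> 1"
          by linarith
      qed
    qed (use c p in auto)
  next
    case False
    text \<open>No data satisfy the hypotheses for such an \<open>\<alpha>\<close>.\<close>
    have vacuous: "False"
      if "0 < \<Lambda>" "real_distribution D" "F = cdf D" "\<Lambda> * (\<Sum>j\<in>{1..J}. 1 / \<mu> j) < 1"
        "\<forall>a\<in>A. 1 - left_lim F a > 0" "is_arg_max (\<lambda>a. a * \<Lambda> * (1 - left_lim F a)) (\<lambda>a. a \<in> A) a"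
        "\<alpha> = \<Lambda> * (1 - left_lim F a)" for \<Lambda> A D F a
    proof -
      have "0 \<le> left_lim F a"
        using left_lim_cdf[OF that(2)] that(3) by simp
      then have "\<alpha> \<le> \<Lambda>" using that(1,7) by (simp add: mult_left_le)
      then have "\<alpha> * residual 1 \<le> \<Lambda> * residual 1"
        using residual_pos by (intro mult_right_mono) auto
      moreover have "\<Lambda> * residual 1 < 1" using that(4) by (simp add: residual_def)
      moreover have "0 \<le> \<alpha>" using that(1,5,6,7) by (auto simp: is_arg_max_def less_imp_le)
      ultimately show False using False by linarith
    qed
    show ?thesis
      by (rule exI[of _ 1], rule exI[of _ "1 / 2"]) (use vacuous in \<open>blast | simp\<close>)+
  qed
qed

end
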